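(* Let $G$ be a connected non-bipartite graph on the vertex set $[n]=\{1,\dots,n\}$. Then the following are equivalent: (i) $L_G$ is a complete intersection; (ii) $G$ is an odd cycle; (iii) $\mathcal{I}_G$ is a complete intersection.
   Context: All graphs are finite and simple. Let $\mathbb{K}$ be any field and $S=\mathbb{K}[x_1,\dots,x_n,y_1,\dots,y_n]$. For a graph $G$ on $[n]$, the Lovász-Saks-Schrijver (LSS) ideal is $L_G=(x_ix_j+y_iy_j : \{i,j\}\in E(G))\subset S$ and the parity binomial edge ideal is $\mathcal{I}_G=(x_ix_j-y_iy_j : \{i,j\}\in E(G))\subset S$. A homogeneous ideal $I$ of $S$ is a complete intersection if $\mu(I)=\operatorname{ht}(I)$, where $\mu(I)$ is the cardinality of a minimal homogeneous generating set of $I$ and $\operatorname{ht}(I)$ its height. An odd cycle is a cycle graph with an odd number of vertices. *)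

theory Defs
  imports
    "HOL-Library.Poly_Mapping"
    "HOL-Library.Extended_Nat"
    "HOL-Algebra.Ideal"
begin

subsection \<open>Polynomial rings\<close>

text \<open>
  A monomial is a finitely supported exponent vector, a polynomial a finitely supported
  coefficient function on monomials; \<open>(*)\<close> is convolution.
\<close>

type_synonym ('v, 'k) mpoly = "('v \<Rightarrow>\<^sub>0 nat) \<Rightarrow>\<^sub>0 'k"

definition var :: "'v \<Rightarrow> ('v, 'k::comm_ring_1) mpoly" where
  "var v = Poly_Mapping.single (Poly_Mapping.single v 1) 1"

text \<open>The ring \<open>k[v : v \<in> V]\<close>, as a subring of the polynomials in all variables of type \<open>'v\<close>.\<close>

definition poly_ring :: "'v set \<Rightarrow> ('v, 'k::comm_ring_1) mpoly ring" where
  "poly_ring V = \<lparr>carrier = {p. \<forall>m\<in>Poly_Mapping.keys p. Poly_Mapping.keys m \<subseteq> V},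
     mult = (*), one = 1, zero = 0, add = (+)\<rparr>"

lemma cring_poly_ring: "cring (poly_ring V :: ('v, 'k::comm_ring_1) mpoly ring)"
proof -
  define C where "C = {p :: ('v, 'k) mpoly. \<forall>m\<in>Poly_Mapping.keys p. Poly_Mapping.keys m \<subseteq> V}"
  have R: "poly_ring V = \<lparr>carrier = C, mult = (*), one = 1, zero = 0, add = (+)\<rparr>"
    by (simp add: poly_ring_def C_def)
  have zero: "0 \<in> C" and one: "1 \<in> C"
    by (auto simp: C_def)
  have add: "p + q \<in> C" if "p \<in> C" "q \<in> C" for p q
    using that Poly_Mapping.keys_add[of p q] unfolding C_def by blast
  have uminus: "- p \<in> C" if "p \<in> C" for p
    using that by (simp add: C_def)
  have mult: "p * q \<in> C" if pq: "p \<in> C" "q \<in> C" for p q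
  proof -
    have "Poly_Mapping.keys m \<subseteq> V" if m_in: "m \<in> Poly_Mapping.keys (p * q)" for m
    proof -
      obtain a b where m: "m = a + b" and "a \<in> Poly_Mapping.keys p" "b \<in> Poly_Mapping.keys q"
        using m_in keys_mult[of p q] by blast
      then have "Poly_Mapping.keys a \<subseteq> V" "Poly_Mapping.keys b \<subseteq> V"
        using pq by (simp_all add: C_def)
      then show ?thesis unfolding m using Poly_Mapping.keys_add[of a b] by blast
    qed
    then show ?thesis by (simp add: C_def)
  qed
  show ?thesis
    unfolding R
  proof (rule cringI)
    show "abelian_group \<lparr>carrier = C, mult = (*), one = 1, zero = 0, add = (+)\<rparr>"
    proof (rule abelian_groupI, goal_cases)
      case (6 p)
      then show ?case using uminus[of p] by (auto intro: bexI[of _ "- p"])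
    qed (simp_all add: zero add ac_simps)
    show "Group.comm_monoid \<lparr>carrier = C, mult = (*), one = 1, zero = 0, add = (+)\<rparr>"
      by (rule comm_monoidI) (simp_all add: one mult ac_simps)
  qed (simp add: distrib_right)
qed

lemma var_in_poly_ring: "v \<in> V \<Longrightarrow> var v \<in> carrier (poly_ring V)"
  by (auto simp: poly_ring_def var_def)

definition mdegree :: "('v \<Rightarrow>\<^sub>0 nat) \<Rightarrow> nat" where
  "mdegree m = (\<Sum>v\<in>Poly_Mapping.keys m. Poly_Mapping.lookup m v)"

definition homogeneous :: "('v, 'k::comm_ring_1) mpoly \<Rightarrow> bool" where
  "homogeneous p \<longleftrightarrow> (\<exists>d. \<forall>m\<in>Poly_Mapping.keys p. mdegree m = d)"


subsection \<open>Height, number of generators, complete intersections\<close>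

text \<open>The height of a prime \<open>P\<close> is the supremum of the lengths \<open>r\<close> of chains
  \<open>C 0 \<subset> \<dots> \<subset> C r = P\<close> of primes; the infimum over the primes containing an ideal
  is \<open>\<infinity>\<close> for the unit ideal.\<close>

definition prime_height :: "('a, 'm) ring_scheme \<Rightarrow> 'a set \<Rightarrow> enat" where
  "prime_height R P = Sup {enat r | r. \<exists>C :: nat \<Rightarrow> 'a set.
     (\<forall>i\<le>r. primeideal (C i) R) \<and> (\<forall>i<r. C i \<subset> C (Suc i)) \<and> C r = P}"

definition height :: "('a, 'm) ring_scheme \<Rightarrow> 'a set \<Rightarrow> enat" where
  "height R I = Inf {prime_height R P | P. primeideal P R \<and> I \<subseteq> P}"

definition hom_gen_set ::
    "'v set \<Rightarrow> ('v, 'k::comm_ring_1) mpoly set \<Rightarrow> ('v, 'k) mpoly set \<Rightarrow> bool" where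
  "hom_gen_set V I B \<longleftrightarrow>
     B \<subseteq> carrier (poly_ring V) \<and> (\<forall>p\<in>B. homogeneous p) \<and> genideal (poly_ring V) B = I"

definition minimal_hom_gen_set ::
    "'v set \<Rightarrow> ('v, 'k::comm_ring_1) mpoly set \<Rightarrow> ('v, 'k) mpoly set \<Rightarrow> bool" where
  "minimal_hom_gen_set V I B \<longleftrightarrow> hom_gen_set V I B \<and> (\<forall>B'. B' \<subset> B \<longrightarrow> \<not> hom_gen_set V I B')"

text \<open>Over a field and for finite \<open>V\<close>, the minimal homogeneous generating sets of a homogeneous
  ideal are finite and have the same cardinality, by graded Nakayama.\<close>

definition num_gens :: "'v set \<Rightarrow> ('v, 'k::field) mpoly set \<Rightarrow> nat" where
  "num_gens V I = (THE m. \<exists>B. minimal_hom_gen_set V I B \<and> card B = m)"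

definition homogeneous_ideal :: "'v set \<Rightarrow> ('v, 'k::comm_ring_1) mpoly set \<Rightarrow> bool" where
  "homogeneous_ideal V I \<longleftrightarrow> ideal I (poly_ring V) \<and> (\<exists>B. hom_gen_set V I B)"

definition complete_intersection :: "'v set \<Rightarrow> ('v, 'k::field) mpoly set \<Rightarrow> bool" where
  "complete_intersection V I \<longleftrightarrow>
     homogeneous_ideal V I \<and> enat (num_gens V I) = height (poly_ring V) I"


subsection \<open>Graphs\<close>

text \<open>A graph is given by its vertex set and its set of edges, which are two-element sets of
  vertices.\<close>

definition simple_graph :: "'a set \<Rightarrow> 'a set set \<Rightarrow> bool" where
  "simple_graph V E \<longleftrightarrow> finite V \<and> (\<forall>e\<in>E. e \<subseteq> V \<and> card e = 2)"

definition connected_graph :: "'a set \<Rightarrow> 'a set set \<Rightarrow> bool" where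
  "connected_graph V E \<longleftrightarrow> V \<noteq> {} \<and> (\<forall>u\<in>V. \<forall>v\<in>V. (u, v) \<in> {(a, b). {a, b} \<in> E}\<^sup>*)"

definition bipartite_graph :: "'a set \<Rightarrow> 'a set set \<Rightarrow> bool" where
  "bipartite_graph V E \<longleftrightarrow>
     (\<exists>A B. A \<union> B = V \<and> A \<inter> B = {} \<and> (\<forall>e\<in>E. \<exists>a\<in>A. \<exists>b\<in>B. e = {a, b}))"

text \<open>The bound \<open>3 \<le> card V\<close> excludes the degenerate cyclic enumerations of at most two
  vertices.\<close>

definition cycle_graph :: "'a set \<Rightarrow> 'a set set \<Rightarrow> bool" where
  "cycle_graph V E \<longleftrightarrow> finite V \<and> 3 \<le> card V \<and>
     (\<exists>c. bij_betw c {..<card V} V \<and> E = {{c i, c (Suc i mod card V)} | i. i < card V})"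

definition odd_cycle :: "'a set \<Rightarrow> 'a set set \<Rightarrow> bool" where
  "odd_cycle V E \<longleftrightarrow> cycle_graph V E \<and> odd (card V)"


subsection \<open>The two ideals of a graph on \<open>{1..n}\<close>\<close>

datatype xy = X nat | Y nat

definition xy_vars :: "nat \<Rightarrow> xy set" where
  "xy_vars n = X ` {1..n} \<union> Y ` {1..n}"

definition LSS_ideal :: "nat \<Rightarrow> nat set set \<Rightarrow> (xy, 'k::field) mpoly set" where
  "LSS_ideal n E = genideal (poly_ring (xy_vars n))
     {var (X i) * var (X j) + var (Y i) * var (Y j) | i j. {i, j} \<in> E}"

definition parity_binomial_edge_ideal ::
    "nat \<Rightarrow> nat set set \<Rightarrow> (xy, 'k::field) mpoly set" where
  "parity_binomial_edge_ideal n E = genideal (poly_ring (xy_vars n))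
     {var (X i) * var (X j) - var (Y i) * var (Y j) | i j. {i, j} \<in> E}"

end

theory Submission
  imports "HOL-Computational_Algebra.Polynomial" Defs
begin

text \<open>
  Both ideals are the case \<open>c = 1\<close>, \<open>c = -1\<close> of the ideal generated by the
  \<open>x\<^sub>i x\<^sub>j + c y\<^sub>i y\<^sub>j\<close>, which is minimally generated by one quadric per edge. In a polynomial ring,
  the height of a prime \<open>P\<close> is the number of variables outside a maximal set of variables that
  is algebraically independent modulo \<open>P\<close>.

  If \<open>G\<close> is an odd cycle, a prime containing the ideal is a domain-valued point with
  consecutive vectors \<open>(x\<^sub>i, y\<^sub>i)\<close> orthogonal, so vectors joined by a stretch without zero vectors are
  parallel or orthogonal. Hence between two vertices both of whose variables are independent
  there is a vertex with zero vector, which bounds the number of independent variables by \<open>n\<close>.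
  Conversely, setting the variables of one vertex \<open>v\<close> to zero and parametrising the zero set of
  the rest componentwise gives height at most \<open>2 + |E| - deg v\<close>. So a complete intersection has
  maximum degree at most \<open>2\<close>, and a connected non-bipartite graph with this property is an odd
  cycle.
\<close>

section \<open>Polynomials and substitution\<close>

text \<open>Krull's height theorem is avoided: upper bounds on the height come from exhibiting many
  variables independent modulo an ideal containing the edge ideal. With no vertex set to zero this
  already gives height at most |E|. Over an arbitrary field 1 + c t^2 may be irreducible, split, or
  be a square (characteristic 2). The parametrisation therefore takes values in polynomials in t,
  and divisibility by 1 + c t^2 replaces vanishing. The resulting ideal need not be prime, so the
  upper bound on heights is proved for arbitrary ideals. Each remaining vertex gives one scalar
  parameter and each properly coloured class one common direction q. On a vertex set U with edge set
  F these are at least 2|U| - |F| parameters. Setting v to zero loses two parameters and saves deg v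
  edges. Oddness enters when the two independent vertices on the cycle coincide: once around an odd
  cycle, a vector becomes orthogonal to itself, and x^2 + c y^2 is a nonzero polynomial. Around an
  even cycle it only becomes parallel to itself, and no zero vector is forced.\<close>

abbreviation Const :: "'k \<Rightarrow> ('v, 'k::comm_ring_1) mpoly" where
  "Const a \<equiv> Poly_Mapping.single 0 a"

abbreviation mpolys :: "'v set \<Rightarrow> ('v, 'k::comm_ring_1) mpoly set" where
  "mpolys V \<equiv> carrier (poly_ring V)"

lemma poly_ring_simps [simp]:
  "mult (poly_ring V) = (*)" "one (poly_ring V) = 1"
  "zero (poly_ring V) = 0" "add (poly_ring V) = (+)"
  by (simp_all add: poly_ring_def)

lemma mpolys_iff: "p \<in> mpolys V \<longleftrightarrow> (\<forall>m\<in>Poly_Mapping.keys p. Poly_Mapping.keys m \<subseteq> V)"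
  by (simp add: poly_ring_def)

lemma mpolys_closed [simp]:
  fixes p q :: "('v, 'k::comm_ring_1) mpoly"
  shows "0 \<in> mpolys V" "1 \<in> mpolys V"
    "p \<in> mpolys V \<Longrightarrow> q \<in> mpolys V \<Longrightarrow> p + q \<in> mpolys V"
    "p \<in> mpolys V \<Longrightarrow> q \<in> mpolys V \<Longrightarrow> p * q \<in> mpolys V"
    "p \<in> mpolys V \<Longrightarrow> - p \<in> mpolys V"
    "p \<in> mpolys V \<Longrightarrow> q \<in> mpolys V \<Longrightarrow> p - q \<in> mpolys V"
proof -
  interpret R: cring "poly_ring V :: ('v, 'k) mpoly ring"
    by (rule cring_poly_ring)
  show "0 \<in> mpolys V" "1 \<in> mpolys V"
    by (simp_all add: mpolys_iff)
  show add: "p + q \<in> mpolys V" if "p \<in> mpolys V" "q \<in> mpolys V" for p q :: "('v, 'k) mpoly"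
    using R.add.m_closed[OF that] by simp
  show "p * q \<in> mpolys V" if "p \<in> mpolys V" "q \<in> mpolys V"
    using R.m_closed[OF that] by simp
  show minus: "- p \<in> mpolys V" if "p \<in> mpolys V" for p :: "('v, 'k) mpoly"
    using that by (simp add: mpolys_iff)
  show "p - q \<in> mpolys V" if "p \<in> mpolys V" "q \<in> mpolys V"
    using add[OF that(1) minus[OF that(2)]] by simp
qed

lemma Const_in_mpolys [simp]: "Const a \<in> mpolys V"
  by (simp add: mpolys_iff)

lemma var_in_mpolys [simp]: "v \<in> V \<Longrightarrow> var v \<in> mpolys V"
  by (rule var_in_poly_ring)

lemma mpolys_mono: "U \<subseteq> V \<Longrightarrow> mpolys U \<subseteq> mpolys V"
  by (fastforce simp: mpolys_iff)

lemma mpolys_empty: "p \<in> mpolys {} \<Longrightarrow> p = Const (Poly_Mapping.lookup p 0)"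
  by (rule poly_mapping_eqI)
     (auto simp: mpolys_iff lookup_single when_def in_keys_iff)

lemma sum_monomials: "(\<Sum>m\<in>Poly_Mapping.keys p. Poly_Mapping.single m (Poly_Mapping.lookup p m)) = p"
proof (rule poly_mapping_eqI)
  fix k
  have "Poly_Mapping.lookup (\<Sum>m\<in>Poly_Mapping.keys p. Poly_Mapping.single m (Poly_Mapping.lookup p m)) k
    = (\<Sum>m\<in>Poly_Mapping.keys p. if m = k then Poly_Mapping.lookup p m else 0)"
    by (simp add: lookup_sum lookup_single when_def)
  also have "\<dots> = Poly_Mapping.lookup p k"
    by (auto simp: sum.delta in_keys_iff)
  finally show "Poly_Mapping.lookup (\<Sum>m\<in>Poly_Mapping.keys p. Poly_Mapping.single m (Poly_Mapping.lookup p m)) k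
    = Poly_Mapping.lookup p k" .
qed

lemma mdegree_add: "mdegree (m + m') = mdegree m + mdegree m'"
proof -
  have *: "mdegree n = (\<Sum>v\<in>Poly_Mapping.keys m \<union> Poly_Mapping.keys m'. Poly_Mapping.lookup n v)"
    if "Poly_Mapping.keys n \<subseteq> Poly_Mapping.keys m \<union> Poly_Mapping.keys m'" for n :: "'a \<Rightarrow>\<^sub>0 nat"
    unfolding mdegree_def using that by (intro sum.mono_neutral_left) (auto simp: in_keys_iff)
  show ?thesis
    using Poly_Mapping.keys_add[of m m'] by (subst (1 2 3) *) (auto simp: lookup_add sum.distrib)
qed

lemma mdegree_single [simp]: "mdegree (Poly_Mapping.single v k) = k"
  by (simp add: mdegree_def)

lemma mdegree_zero [simp]: "mdegree 0 = 0"
  by (simp add: mdegree_def)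

lemma single_in_keys_split:
  fixes m :: "'v \<Rightarrow>\<^sub>0 nat"
  assumes "v \<in> Poly_Mapping.keys m"
  shows "m = Poly_Mapping.single v 1 + (m - Poly_Mapping.single v 1)"
  using assms by (intro poly_mapping_eqI) (auto simp: lookup_add lookup_minus lookup_single when_def in_keys_iff)

lemma exponent_induct [consumes 1, case_names zero add]:
  assumes "Poly_Mapping.keys m \<subseteq> V"
    and "P 0"
    and "\<And>v m. v \<in> V \<Longrightarrow> Poly_Mapping.keys m \<subseteq> V \<Longrightarrow> P m \<Longrightarrow> P (Poly_Mapping.single v 1 + m)"
  shows "P (m :: 'v \<Rightarrow>\<^sub>0 nat)"
  using assms(1)
proof (induction "mdegree m" arbitrary: m rule: less_induct)
  case less
  show ?case
  proof (cases "m = 0")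
    case False
    then obtain v where v: "v \<in> Poly_Mapping.keys m"
      by (metis ex_in_conv keys_eq_empty)
    define m' where "m' = m - Poly_Mapping.single v 1"
    have m: "m = Poly_Mapping.single v 1 + m'"
      unfolding m'_def by (rule single_in_keys_split[OF v])
    have "mdegree m' < mdegree m"
      by (subst m) (simp add: mdegree_add)
    moreover have "Poly_Mapping.keys m' \<subseteq> V"
      using less.prems by (subst (asm) m) (auto simp: in_keys_iff lookup_add subset_iff)
    ultimately have "P m'" by (rule less.hyps)
    then have "P (Poly_Mapping.single v 1 + m')"
      using assms(3) less.prems v \<open>Poly_Mapping.keys m' \<subseteq> V\<close> by blast
    then show ?thesis using m by simp
  qed (simp add: assms(2))
qed

text \<open>The step multiplies by a single variable, so statements about a ring homomorphism reduce
  to its values on constants and variables.\<close>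

lemma mpolys_induct [consumes 1, case_names Const var add]:
  assumes "p \<in> mpolys V"
    and C: "\<And>a. P (Const a)"
    and M: "\<And>p v. p \<in> mpolys V \<Longrightarrow> v \<in> V \<Longrightarrow> P p \<Longrightarrow> P (var v * p)"
    and A: "\<And>p q. p \<in> mpolys V \<Longrightarrow> q \<in> mpolys V \<Longrightarrow> P p \<Longrightarrow> P q \<Longrightarrow> P (p + q)"
  shows "P (p :: ('v, 'k::comm_ring_1) mpoly)"
proof -
  have single: "P (Poly_Mapping.single m a) \<and> Poly_Mapping.single m a \<in> mpolys V"
    if "Poly_Mapping.keys m \<subseteq> V" for m a
    using that
  proof (induction m rule: exponent_induct)
    case (add v m)
    have "Poly_Mapping.single (Poly_Mapping.single v 1 + m) a = var v * Poly_Mapping.single m a"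
      by (simp add: var_def mult_single)
    then show ?case using M add by auto
  qed (simp add: C)
  have "P (\<Sum>m\<in>A. Poly_Mapping.single m (Poly_Mapping.lookup p m)) \<and>
        (\<Sum>m\<in>A. Poly_Mapping.single m (Poly_Mapping.lookup p m)) \<in> mpolys V"
    if "A \<subseteq> Poly_Mapping.keys p" for A
    using finite_subset[OF that finite_keys] that
  proof (induction A rule: finite_induct)
    case empty
    then show ?case using C[of 0] by simp
  next
    case (insert m A)
    have "Poly_Mapping.keys m \<subseteq> V"
      using insert.prems assms(1) by (auto simp: mpolys_iff)
    then show ?case
      using insert A single by auto
  qed
  from this[of "Poly_Mapping.keys p"] show ?thesis by (simp add: sum_monomials)
qed

section \<open>Substitution with values in polynomials in one further variable t\<close>

definition mon_subst :: "('v \<Rightarrow> 'r::comm_ring_1) \<Rightarrow> ('v \<Rightarrow>\<^sub>0 nat) \<Rightarrow> 'r" where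
  "mon_subst s m = (\<Prod>v\<in>Poly_Mapping.keys m. s v ^ Poly_Mapping.lookup m v)"

lemma mon_subst_add: "mon_subst s (m + m') = mon_subst s m * mon_subst s m'"
proof -
  have *: "mon_subst s n = (\<Prod>v\<in>Poly_Mapping.keys m \<union> Poly_Mapping.keys m'. s v ^ Poly_Mapping.lookup n v)"
    if "Poly_Mapping.keys n \<subseteq> Poly_Mapping.keys m \<union> Poly_Mapping.keys m'" for n
    unfolding mon_subst_def using that by (intro prod.mono_neutral_left) (auto simp: in_keys_iff)
  show ?thesis
    using Poly_Mapping.keys_add[of m m']
    by (subst (1 2 3) *) (auto simp: lookup_add prod.distrib power_add)
qed

text \<open>The further variable t has three uses: it is the isolated variable in
  \<open>isolate\<close>, the grading variable in \<open>hcomp\<close>, and the root of 1 + c t^2 in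
  the parametrisation of the zero set.\<close>

definition subst ::
    "('v \<Rightarrow> ('w, 'k) mpoly poly) \<Rightarrow> ('v, 'k::comm_ring_1) mpoly \<Rightarrow> ('w, 'k) mpoly poly" where
  "subst s p = (\<Sum>m\<in>Poly_Mapping.keys p. [:Const (Poly_Mapping.lookup p m):] * mon_subst s m)"

lemma subst_superset:
  assumes "finite A" "Poly_Mapping.keys p \<subseteq> A"
  shows "subst s p = (\<Sum>m\<in>A. [:Const (Poly_Mapping.lookup p m):] * mon_subst s m)"
  unfolding subst_def using assms by (intro sum.mono_neutral_left) (auto simp: in_keys_iff)

lemma subst_add [simp]: "subst s (p + q) = subst s p + subst s q"
proof -
  let ?A = "Poly_Mapping.keys p \<union> Poly_Mapping.keys q"
  have "subst s r = (\<Sum>m\<in>?A. [:Const (Poly_Mapping.lookup r m):] * mon_subst s m)"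
    if "Poly_Mapping.keys r \<subseteq> ?A" for r
    using that by (intro subst_superset) auto
  then show ?thesis
    using Poly_Mapping.keys_add[of p q]
    by (simp add: lookup_add single_add sum.distrib smult_add_left)
qed

lemma subst_single: "subst s (Poly_Mapping.single m a) = [:Const a:] * mon_subst s m"
  by (simp add: subst_def)

lemma subst_Const [simp]: "subst s (Const a) = [:Const a:]"
  by (simp add: subst_single mon_subst_def)

lemma subst_0 [simp]: "subst s 0 = 0"
  by (simp add: subst_def)

lemma subst_1 [simp]: "subst s 1 = 1"
  using subst_Const[of s 1] by (simp add: one_pCons)

lemma subst_var [simp]: "subst s (var v) = s v"
  by (simp add: var_def subst_single mon_subst_def flip: one_pCons)

lemma subst_sum: "subst s (sum f A) = (\<Sum>i\<in>A. subst s (f i))"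
  by (induction A rule: infinite_finite_induct) auto

lemma Const_mult_pCons: "[:Const (a * b):] = [:Const a:] * [:Const b:]"
  by (simp add: mult_single mult.commute)

lemma subst_mult [simp]: "subst s (p * q) = subst s p * subst s q"
proof -
  have 1: "subst s (Poly_Mapping.single m a * Poly_Mapping.single m' b) =
      subst s (Poly_Mapping.single m a) * subst s (Poly_Mapping.single m' b)" for m m' a b
    by (simp only: mult_single subst_single mon_subst_add add_0_left Const_mult_pCons ac_simps)
  have "subst s ((\<Sum>m\<in>Poly_Mapping.keys p. Poly_Mapping.single m (Poly_Mapping.lookup p m)) *
      (\<Sum>m\<in>Poly_Mapping.keys q. Poly_Mapping.single m (Poly_Mapping.lookup q m))) =
    subst s (\<Sum>m\<in>Poly_Mapping.keys p. Poly_Mapping.single m (Poly_Mapping.lookup p m)) *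
    subst s (\<Sum>m\<in>Poly_Mapping.keys q. Poly_Mapping.single m (Poly_Mapping.lookup q m))"
    by (simp add: sum_product subst_sum 1)
  then show ?thesis by (simp add: sum_monomials)
qed

definition isolate :: "'v \<Rightarrow> ('v, 'k::comm_ring_1) mpoly \<Rightarrow> ('v, 'k) mpoly poly" where
  "isolate z = subst (\<lambda>v. if v = z then [:0, 1:] else [:var v:])"

lemma isolate_hom [simp]:
  "isolate z (p + q) = isolate z p + isolate z q"
  "isolate z (p * q) = isolate z p * isolate z q"
  "isolate z 0 = 0" "isolate z 1 = 1" "isolate z (Const a) = [:Const a:]"
  by (simp_all add: isolate_def)

lemma isolate_var: "isolate z (var v) = (if v = z then [:0, 1:] else [:var v:])"
  by (simp add: isolate_def)

lemma poly_isolate [simp]: "poly (isolate z p) (var z) = p"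
proof -
  have "p \<in> mpolys UNIV" by (simp add: mpolys_iff)
  then show ?thesis
    by (induction p rule: mpolys_induct) (auto simp: isolate_var)
qed

lemma coeff_isolate:
  assumes "p \<in> mpolys V"
  shows "coeff (isolate z p) i \<in> mpolys (V - {z})"
  using assms
proof (induction p arbitrary: i rule: mpolys_induct)
  case (Const a)
  then show ?case by (simp add: coeff_pCons split: nat.split)
next
  case (var p v)
  then show ?case by (auto simp: isolate_var coeff_pCons split: nat.split)
next
  case (add p q)
  then show ?case by simp
qed

lemma isolate_free:
  assumes "p \<in> mpolys V" "z \<notin> V"
  shows "isolate z p = [:p:]"
  using assms(1) assms(2)
  by (induction p rule: mpolys_induct) (auto simp: isolate_var)

section \<open>Primes in subrings\<close>

text \<open>Subrings, ideals and primes are sets inside one ring type, so that k[W] and k[V] share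
  their arithmetic and the type \<open>poly\<close> applies. \<open>primeideal_poly_ring_iff\<close>
  translates back.\<close>

definition is_subring :: "'r::comm_ring_1 set \<Rightarrow> bool" where
  "is_subring S \<longleftrightarrow> 1 \<in> S \<and> (\<forall>a\<in>S. \<forall>b\<in>S. a - b \<in> S \<and> a * b \<in> S)"

lemma is_subringD:
  assumes "is_subring S"
  shows "0 \<in> S" "1 \<in> S" "a \<in> S \<Longrightarrow> - a \<in> S"
    "a \<in> S \<Longrightarrow> b \<in> S \<Longrightarrow> a + b \<in> S" "a \<in> S \<Longrightarrow> b \<in> S \<Longrightarrow> a - b \<in> S"
    "a \<in> S \<Longrightarrow> b \<in> S \<Longrightarrow> a * b \<in> S" "a \<in> S \<Longrightarrow> a ^ n \<in> S"
proof -
  show one: "1 \<in> S" and diff: "a \<in> S \<Longrightarrow> b \<in> S \<Longrightarrow> a - b \<in> S"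
    and mult: "a \<in> S \<Longrightarrow> b \<in> S \<Longrightarrow> a * b \<in> S" for a b
    using assms by (auto simp: is_subring_def)
  show zero: "0 \<in> S" using diff[OF one one] by simp
  show minus: "a \<in> S \<Longrightarrow> - a \<in> S" for a using diff[OF zero] by simp
  show "a \<in> S \<Longrightarrow> b \<in> S \<Longrightarrow> a + b \<in> S" using diff[of a "- b"] minus[of b] by simp
  show "a \<in> S \<Longrightarrow> a ^ n \<in> S" by (induction n) (auto simp: one mult)
qed

lemma is_subring_sum: "is_subring S \<Longrightarrow> (\<And>i. i \<in> A \<Longrightarrow> f i \<in> S) \<Longrightarrow> sum f A \<in> S"
  by (induction A rule: infinite_finite_induct) (auto simp: is_subringD)

lemma is_subring_mpolys: "is_subring (mpolys V)"
  by (simp add: is_subring_def)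

definition ideal_in :: "'r::comm_ring_1 set \<Rightarrow> 'r set \<Rightarrow> bool" where
  "ideal_in S I \<longleftrightarrow> I \<subseteq> S \<and> 0 \<in> I \<and> (\<forall>a\<in>I. \<forall>b\<in>I. a + b \<in> I) \<and> (\<forall>s\<in>S. \<forall>a\<in>I. s * a \<in> I)"

definition prime_in :: "'r::comm_ring_1 set \<Rightarrow> 'r set \<Rightarrow> bool" where
  "prime_in S P \<longleftrightarrow> ideal_in S P \<and> 1 \<notin> P \<and> (\<forall>a\<in>S. \<forall>b\<in>S. a * b \<in> P \<longrightarrow> a \<in> P \<or> b \<in> P)"

lemma ideal_inD:
  assumes "ideal_in S I"
  shows "a \<in> I \<Longrightarrow> a \<in> S" "0 \<in> I" "a \<in> I \<Longrightarrow> b \<in> I \<Longrightarrow> a + b \<in> I"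
    "s \<in> S \<Longrightarrow> a \<in> I \<Longrightarrow> s * a \<in> I" "s \<in> S \<Longrightarrow> a \<in> I \<Longrightarrow> a * s \<in> I"
  using assms unfolding ideal_in_def by (auto simp: mult.commute)

lemma ideal_in_diff:
  assumes "ideal_in S I" "is_subring S" "a \<in> I" "b \<in> I"
  shows "a - b \<in> I"
  using ideal_inD(3)[OF assms(1,3), of "-1 * b"] ideal_inD(4)[OF assms(1) _ assms(4), of "-1"]
    is_subringD(2,3)[OF assms(2)] by simp

lemma ideal_in_sum: "ideal_in S I \<Longrightarrow> (\<And>i. i \<in> A \<Longrightarrow> f i \<in> I) \<Longrightarrow> sum f A \<in> I"
  by (induction A rule: infinite_finite_induct) (auto simp: ideal_inD)

lemma prime_inD:
  assumes "prime_in S P"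
  shows "ideal_in S P" "1 \<notin> P" "a \<in> S \<Longrightarrow> b \<in> S \<Longrightarrow> a * b \<in> P \<Longrightarrow> a \<in> P \<or> b \<in> P"
  using assms unfolding prime_in_def by auto

lemma prime_in_power:
  assumes "prime_in S P" "is_subring S" "a \<in> S" "a \<notin> P"
  shows "a ^ n \<notin> P"
proof (induction n)
  case (Suc n)
  then show ?case
    using prime_inD(3)[OF assms(1,3), of "a ^ n"] is_subringD(7)[OF assms(2,3)] assms(4) by auto
qed (use prime_inD(2)[OF assms(1)] in simp)

section \<open>Univariate polynomials with coefficients in a subring, and pseudo-division\<close>

definition coeffs_in :: "'r::comm_ring_1 set \<Rightarrow> 'r poly \<Rightarrow> bool" where
  "coeffs_in R p \<longleftrightarrow> (\<forall>i. coeff p i \<in> R)"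

lemma coeffs_in_closed:
  assumes "is_subring R"
  shows "coeffs_in R 0" "a \<in> R \<Longrightarrow> coeffs_in R (monom a n)"
    "coeffs_in R p \<Longrightarrow> coeffs_in R q \<Longrightarrow> coeffs_in R (p + q)"
    "coeffs_in R p \<Longrightarrow> coeffs_in R q \<Longrightarrow> coeffs_in R (p - q)"
    "coeffs_in R p \<Longrightarrow> coeffs_in R q \<Longrightarrow> coeffs_in R (p * q)"
    "a \<in> R \<Longrightarrow> coeffs_in R p \<Longrightarrow> coeffs_in R (smult a p)"
  using is_subringD[OF assms]
  by (auto simp: coeffs_in_def coeff_monom coeff_mult intro!: is_subring_sum[OF assms])

lemma poly_in_subring:
  assumes "is_subring S" "coeffs_in S p" "z \<in> S"
  shows "poly p z \<in> S"
  unfolding poly_altdef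
  using assms by (intro is_subring_sum) (auto simp: coeffs_in_def is_subringD)

lemma poly_in_ideal:
  assumes "is_subring S" "ideal_in S I" "coeffs_in I p" "z \<in> S"
  shows "poly p z \<in> I"
  unfolding poly_altdef
  using assms by (intro ideal_in_sum[OF assms(2)]) (auto simp: coeffs_in_def is_subringD ideal_inD)

lemma degree_minus_leading_monom:
  assumes "degree p > 0"
  shows "degree (p - monom (lead_coeff p) (degree p)) < degree p"
proof -
  have "degree (p - monom (lead_coeff p) (degree p)) \<le> degree p - 1"
  proof (rule degree_le, safe)
    fix i assume "i > degree p - 1"
    then have "i = degree p \<or> i > degree p" by linarith
    then show "coeff (p - monom (lead_coeff p) (degree p)) i = 0"
      by (auto simp: coeff_eq_0 coeff_monom)
  qed
  then show ?thesis using assms by linarith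
qed

lemma degree_cancel_leading:
  fixes f p :: "'r::comm_ring_1 poly"
  assumes "degree f > 0" "degree f \<le> degree p"
  shows "degree (smult (lead_coeff f) p - monom (lead_coeff p) (degree p - degree f) * f) < degree p"
    (is "degree ?r < _")
proof -
  have "degree ?r \<le> degree p - 1"
  proof (rule degree_le, safe)
    fix i assume i: "i > degree p - 1"
    show "coeff ?r i = 0"
    proof (cases "i = degree p")
      case True
      then show ?thesis using assms by (simp add: coeff_monom_mult)
    next
      case False
      with i have "i > degree p" by linarith
      moreover from this have "coeff f (i - (degree p - degree f)) = 0"
        using assms by (intro coeff_eq_0) linarith
      ultimately show ?thesis by (simp add: coeff_monom_mult coeff_eq_0)
    qed
  qed
  then show ?thesis using assms by linarith
qed

text \<open>Leading coefficients need not be invertible in \<open>R\<close>, so each reduction step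
  multiplies by that of \<open>f\<close>; this produces the power. The bound on
  \<open>degree q\<close> lets \<open>eliminate_element\<close> apply the minimality of a degree to
  \<open>q\<close> as well.\<close>

lemma pseudo_division:
  assumes R: "is_subring R" and f: "coeffs_in R f" "degree f > 0" and p: "coeffs_in R p"
  shows "\<exists>k q r. coeffs_in R q \<and> coeffs_in R r \<and> smult (lead_coeff f ^ k) p = q * f + r \<and>
     degree r < degree f \<and> degree q \<le> degree p - degree f"
  using p
proof (induction "degree p" arbitrary: p rule: less_induct)
  case less
  show ?case
  proof (cases "degree p < degree f")
    case True
    then show ?thesis
      using less.prems coeffs_in_closed(1)[OF R]
      by (intro exI[of _ 0] exI[of _ "0 :: 'a poly"] exI[of _ p]) auto
  next
    case False
    define a b e where "a = lead_coeff f" and "b = lead_coeff p" and "e = degree p - degree f"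
    define p' where "p' = smult a p - monom b e * f"
    have ab: "a \<in> R" "b \<in> R" using f less.prems by (auto simp: a_def b_def coeffs_in_def)
    have deg: "degree p' < degree p"
      unfolding p'_def a_def b_def e_def using False f(2) by (intro degree_cancel_leading) auto
    have "coeffs_in R p'"
      unfolding p'_def using ab f(1) less.prems by (intro coeffs_in_closed[OF R])
    from less.hyps[OF deg this] obtain k q r where
      qr: "coeffs_in R q" "coeffs_in R r" "smult (a ^ k) p' = q * f + r"
        "degree r < degree f" "degree q \<le> degree p' - degree f"
      unfolding a_def by blast
    let ?q = "q + smult (a ^ k) (monom b e)"
    have "smult (a ^ Suc k) p = ?q * f + r"
      using qr(3) by (simp add: p'_def algebra_simps smult_diff_right)
    moreover have "coeffs_in R ?q"
      using qr(1) ab by (intro coeffs_in_closed[OF R] is_subringD[OF R])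
    moreover have "degree ?q \<le> degree p - degree f"
    proof (rule degree_add_le)
      show "degree q \<le> degree p - degree f" using qr(5) deg by linarith
      show "degree (smult (a ^ k) (monom b e)) \<le> degree p - degree f"
        using degree_smult_le[of "a ^ k" "monom b e"] degree_monom_le[of b e] unfolding e_def by linarith
    qed
    ultimately show ?thesis using qr(2,4) unfolding a_def by blast
  qed
qed

text \<open>The element \<open>z\<close> is algebraic over \<open>R\<close> modulo \<open>P\<close>, so an element of \<open>Q - P\<close> in \<open>R[z]\<close>
  has a nonzero norm to \<open>R\<close>; minimal degrees replace the norm.\<close>

lemma eliminate_element:
  assumes R: "is_subring R" and S: "is_subring S" and RS: "R \<subseteq> S" and z: "z \<in> S"
    and P: "prime_in S P" and Q: "prime_in S Q" and PQ: "P \<subseteq> Q"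
    and f: "coeffs_in R f" "poly f z \<in> Q - P"
    and p: "coeffs_in R p" "poly p z \<in> P" "\<not> coeffs_in P p"
  shows "R \<inter> (Q - P) \<noteq> {}"
proof -
  note Pi = prime_inD(1)[OF P] and Qi = prime_inD(1)[OF Q]
  \<comment> \<open>The aim is that an \<open>f\<close> of least degree is constant, hence itself
    the element sought. \<open>p\<close> is a relation of least degree for \<open>z\<close> modulo
    \<open>P\<close>, where polynomials with all coefficients in \<open>P\<close> count as
    trivial.\<close>
  define F where "F f \<longleftrightarrow> coeffs_in R f \<and> poly f z \<in> Q - P" for f
  define G where "G p \<longleftrightarrow> coeffs_in R p \<and> poly p z \<in> P \<and> \<not> coeffs_in P p" for p
  obtain f where f: "F f" and f_min: "\<And>g. F g \<Longrightarrow> degree f \<le> degree g"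
    using ex_has_least_nat[of F _ degree] f unfolding F_def by blast
  obtain p where p: "G p" and p_min: "\<And>g. G g \<Longrightarrow> degree p \<le> degree g"
    using ex_has_least_nat[of G _ degree] p unfolding G_def by blast
  note cl = coeffs_in_closed[OF R]
  have cS: "coeffs_in R g \<Longrightarrow> coeffs_in S g" for g using RS by (auto simp: coeffs_in_def)
  have ev: "coeffs_in R g \<Longrightarrow> poly g z \<in> S" for g
    using poly_in_subring[OF S cS z] .
  have zpow: "z ^ i \<in> S" for i using is_subringD(7)[OF S z] .
  define a b where "a = lead_coeff f" and "b = lead_coeff p"
  have ab: "a \<in> R" "b \<in> R" using f p by (auto simp: a_def b_def F_def G_def coeffs_in_def)
  have ab_S: "a \<in> S" "b \<in> S" using ab RS by auto
  show ?thesis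
  proof (cases "degree f = 0")
    case True
    then obtain r where "f = [:r:]" by (rule degree_eq_zeroE)
    then have "r \<in> R" "r \<in> Q - P"
      using f by (auto simp: F_def coeffs_in_def dest: spec[of _ 0])
    then show ?thesis by blast
  next
    case False
    then have d: "degree f > 0" by simp
    \<comment> \<open>A leading term with coefficient in \<open>P\<close> could be dropped, changing
      the value only by an element of \<open>P\<close>, against minimality. The same argument serves
      \<open>b\<close>.\<close>
    have a: "a \<notin> P"
    proof
      assume aP: "a \<in> P"
      let ?g = "f - monom a (degree f)"
      have m: "a * z ^ degree f \<in> P" using ideal_inD(5)[OF Pi zpow aP] .
      have e: "poly ?g z = poly f z - a * z ^ degree f" by (simp add: poly_monom)
      have "poly ?g z \<in> Q"
        unfolding e using f m PQ by (intro ideal_in_diff[OF Qi S]) (auto simp: F_def)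
      moreover have "poly ?g z \<notin> P"
      proof
        assume "poly ?g z \<in> P"
        from ideal_inD(3)[OF Pi this m] show False using f by (simp add: poly_monom F_def)
      qed
      ultimately have "F ?g" using f ab by (auto simp: F_def intro!: cl)
      then show False
        using f_min degree_minus_leading_monom[OF d] unfolding a_def by fastforce
    qed
    have b: "b \<notin> P"
    proof
      assume bP: "b \<in> P"
      have dp: "degree p > 0"
      proof (rule ccontr)
        assume "\<not> degree p > 0"
        then have "p = [:b:]" by (auto simp: b_def elim: degree_eq_zeroE)
        then have "coeffs_in P p"
          using bP ideal_inD(2)[OF Pi] by (auto simp: coeffs_in_def coeff_pCons split: nat.split)
        then show False using p by (simp add: G_def)
      qed
      let ?g = "p - monom b (degree p)"
      have m: "b * z ^ degree p \<in> P" using ideal_inD(5)[OF Pi zpow bP] .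
      have "poly ?g z \<in> P"
        using p m by (auto simp: G_def poly_monom intro!: ideal_in_diff[OF Pi S])
      moreover have "\<not> coeffs_in P ?g"
      proof
        assume g: "coeffs_in P ?g"
        have "coeff p i \<in> P" for i
        proof (cases "i = degree p")
          case True
          then show ?thesis using bP by (simp add: b_def)
        next
          case False
          then show ?thesis using g unfolding coeffs_in_def by (auto simp: coeff_monom dest: spec[of _ i])
        qed
        then show False using p by (auto simp: G_def coeffs_in_def)
      qed
      ultimately have "G ?g" using p ab by (auto simp: G_def intro!: cl)
      then show False
        using p_min degree_minus_leading_monom[OF dp] unfolding b_def by fastforce
    qed
    have dp0: "degree p > 0"
    proof (rule ccontr)
      assume "\<not> degree p > 0"
      then have "p = [:b:]" by (auto simp: b_def elim: degree_eq_zeroE)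
      then show False using b p by (simp add: G_def)
    qed
    \<comment> \<open>Otherwise cancelling leading terms against \<open>p\<close> gives, in smaller
      degree, a value congruent to \<open>b * poly f z\<close> modulo \<open>P\<close>, which is
      again in \<open>Q - P\<close>.\<close>
    have less: "degree f < degree p"
    proof (rule ccontr)
      assume "\<not> degree f < degree p"
      then have le: "degree p \<le> degree f" by simp
      let ?g = "smult b f - monom a (degree f - degree p) * p"
      have deg: "degree ?g < degree f"
        unfolding a_def b_def by (rule degree_cancel_leading[OF dp0 le])
      have m: "a * z ^ (degree f - degree p) * poly p z \<in> P"
        using p ab_S zpow by (intro ideal_inD(4)[OF Pi] is_subringD[OF S]) (auto simp: G_def z)
      have e: "poly ?g z = b * poly f z - a * z ^ (degree f - degree p) * poly p z"
        by (simp add: poly_monom)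
      have "poly ?g z \<in> Q"
        unfolding e using f m PQ
        by (intro ideal_in_diff[OF Qi S ideal_inD(4)[OF Qi ab_S(2)]]) (auto simp: F_def)
      moreover have "poly ?g z \<notin> P"
      proof
        assume "poly ?g z \<in> P"
        from ideal_inD(3)[OF Pi this m] have "b * poly f z \<in> P" by (simp add: poly_monom)
        then show False
          using prime_inD(3)[OF P ab_S(2), of "poly f z"] b f ev by (auto simp: F_def)
      qed
      ultimately have "F ?g"
        using f p ab by (auto simp: F_def G_def intro!: cl)
      then show False using f_min deg by fastforce
    qed
    \<comment> \<open>The remainder has its value in \<open>Q\<close>, hence in \<open>P\<close> by
      minimality of \<open>f\<close>; then the value of \<open>q\<close> is in \<open>P\<close> too.
      Both degrees are below that of \<open>p\<close>, so all coefficients of \<open>q\<close> and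
      \<open>r\<close> are in \<open>P\<close>, and so is \<open>a ^ k * b\<close>, contradicting
      primality.\<close>
    obtain k q r where qr: "coeffs_in R q" "coeffs_in R r" "smult (a ^ k) p = q * f + r"
        "degree r < degree f" "degree q \<le> degree p - degree f"
      using pseudo_division[OF R _ d, of p] f p unfolding F_def G_def a_def by blast
    have in_P: "coeffs_in P g" if "coeffs_in R g" "poly g z \<in> P" "degree g < degree p" for g
      using p_min[of g] that unfolding G_def by fastforce
    have ak: "a ^ k \<in> S" "a ^ k \<notin> P"
      using is_subringD(7)[OF S] prime_in_power[OF P S] ab_S a by auto
    have sp: "a ^ k * poly p z \<in> P"
      using p ak by (intro ideal_inD(4)[OF Pi]) (auto simp: G_def)
    have e: "a ^ k * poly p z = poly q z * poly f z + poly r z"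
      using arg_cong[OF qr(3), of "\<lambda>g. poly g z"] by simp
    have "poly r z = a ^ k * poly p z - poly q z * poly f z" using e by simp
    also have "\<dots> \<in> Q"
      using sp PQ f by (intro ideal_in_diff[OF Qi S _ ideal_inD(4)[OF Qi ev[OF qr(1)]]]) (auto simp: F_def)
    finally have rP: "poly r z \<in> P"
      using f_min[of r] qr(2,4) by (auto simp: F_def)
    have "poly q z * poly f z = a ^ k * poly p z - poly r z" using e by simp
    also have "\<dots> \<in> P" by (rule ideal_in_diff[OF Pi S sp rP])
    finally have qP: "poly q z \<in> P"
      using prime_inD(3)[OF P ev[OF qr(1)] ev, of f] f by (auto simp: F_def)
    have "coeffs_in P q" using in_P[OF qr(1) qP] qr(5) d less by simp
    moreover have "coeffs_in P r" using in_P[OF qr(2) rP] qr(4) less by simp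
    ultimately have "coeff (q * f + r) (degree p) \<in> P"
      using f cS[of f] unfolding coeff_add coeff_mult F_def coeffs_in_def
      by (intro ideal_inD(3)[OF Pi] ideal_in_sum[OF Pi] ideal_inD(5)[OF Pi]) auto
    then have "a ^ k * b \<in> P"
      by (simp add: b_def flip: qr(3))
    then show ?thesis
      using prime_inD(3)[OF P ak(1) ab_S(2)] ak(2) b by blast
  qed
qed

text \<open>The extension to \<open>k[V]\<close> of the contraction of \<open>Q\<close> to \<open>k[V - {z}]\<close>.\<close>

definition poly_contraction :: "'v set \<Rightarrow> 'v \<Rightarrow> ('v, 'k::comm_ring_1) mpoly set \<Rightarrow> ('v, 'k) mpoly set" where
  "poly_contraction V z Q = {f \<in> mpolys V. coeffs_in Q (isolate z f)}"

text \<open>Gauss's lemma: if i and j are the last positions with a coefficient outside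
  \<open>P\<close>, every other summand of the coefficient of the product at i + j has a factor in
  \<open>P\<close>.\<close>

lemma coeffs_in_prime_mult:
  assumes S: "is_subring S" and P: "prime_in S P"
    and f: "coeffs_in S f" "\<not> coeffs_in P f" and g: "coeffs_in S g" "\<not> coeffs_in P g"
  shows "\<not> coeffs_in P (f * g)"
proof
  assume fg: "coeffs_in P (f * g)"
  note Pi = prime_inD(1)[OF P]
  have max: "\<exists>i. coeff h i \<notin> P \<and> (\<forall>j>i. coeff h j \<in> P)" if "\<not> coeffs_in P h" for h
  proof -
    have bound: "i \<le> degree h" if "coeff h i \<notin> P" for i
      using that ideal_inD(2)[OF Pi] by (metis le_degree)
    obtain i where "coeff h i \<notin> P" using \<open>\<not> coeffs_in P h\<close> by (auto simp: coeffs_in_def)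
    from ex_has_greatest_nat[of "\<lambda>i. coeff h i \<notin> P", OF this, of "\<lambda>i. i" "Suc (degree h)"] bound
    show ?thesis by (metis le_imp_less_Suc not_less)
  qed
  obtain i where i: "coeff f i \<notin> P" "\<And>k. k > i \<Longrightarrow> coeff f k \<in> P" using max[OF f(2)] by blast
  obtain j where j: "coeff g j \<notin> P" "\<And>k. k > j \<Longrightarrow> coeff g k \<in> P" using max[OF g(2)] by blast
  have fS: "coeff f k \<in> S" and gS: "coeff g k \<in> S" for k
    using f g by (auto simp: coeffs_in_def)
  have "coeff (f * g) (i + j) = coeff f i * coeff g j +
      (\<Sum>k\<in>{..i + j} - {i}. coeff f k * coeff g (i + j - k))"
    unfolding coeff_mult by (subst sum.remove[of _ i]) auto
  moreover have "(\<Sum>k\<in>{..i + j} - {i}. coeff f k * coeff g (i + j - k)) \<in> P"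
  proof (rule ideal_in_sum[OF Pi])
    fix k assume "k \<in> {..i + j} - {i}"
    then have "k > i \<or> i + j - k > j" by auto
    then show "coeff f k * coeff g (i + j - k) \<in> P"
      using i(2) j(2) ideal_inD(4,5)[OF Pi] fS gS by blast
  qed
  ultimately have "coeff f i * coeff g j \<in> P"
    using ideal_in_diff[OF Pi S] fg unfolding coeffs_in_def by (metis add_diff_cancel_right')
  then show False using prime_inD(3)[OF P fS gS] i(1) j(1) by blast
qed

lemma coeffs_in_isolate: "f \<in> mpolys V \<Longrightarrow> coeffs_in (mpolys V) (isolate z f)"
  using coeff_isolate[of f V z] mpolys_mono[of "V - {z}" V] by (auto simp: coeffs_in_def)

lemma prime_in_poly_contraction:
  fixes Q :: "('v, 'k::comm_ring_1) mpoly set"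
  assumes Q: "prime_in (mpolys V) Q"
  shows "prime_in (mpolys V) (poly_contraction V z Q)"
proof -
  note Qi = prime_inD(1)[OF Q]
  let ?C = "poly_contraction V z Q"
  have "ideal_in (mpolys V) ?C"
    unfolding ideal_in_def poly_contraction_def
  proof (intro conjI ballI)
    fix s a :: "('v, 'k) mpoly"
    assume s: "s \<in> mpolys V" and "a \<in> {f \<in> mpolys V. coeffs_in Q (isolate z f)}"
    then have a: "a \<in> mpolys V" "coeffs_in Q (isolate z a)" by auto
    have "coeff (isolate z (s * a)) i \<in> Q" for i
      unfolding isolate_hom coeff_mult
    proof (rule ideal_in_sum[OF Qi])
      fix j
      show "coeff (isolate z s) j * coeff (isolate z a) (i - j) \<in> Q"
        using a(2) coeffs_in_isolate[OF s, of z] by (intro ideal_inD(4)[OF Qi]) (simp_all add: coeffs_in_def)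
    qed
    then have "coeffs_in Q (isolate z (s * a))" by (simp add: coeffs_in_def)
    then show "s * a \<in> {f \<in> mpolys V. coeffs_in Q (isolate z f)}"
      using s a by simp
  qed (auto simp: coeffs_in_def ideal_inD(2,3)[OF Qi])
  moreover have "1 \<notin> ?C"
    using prime_inD(2)[OF Q] by (auto simp: poly_contraction_def coeffs_in_def dest: spec[of _ 0])
  moreover have "a \<in> ?C \<or> b \<in> ?C" if "a \<in> mpolys V" "b \<in> mpolys V" "a * b \<in> ?C" for a b
    using coeffs_in_prime_mult[OF is_subring_mpolys Q coeffs_in_isolate[OF that(1)] _ coeffs_in_isolate[OF that(2)]]
      that by (auto simp: poly_contraction_def)
  ultimately show ?thesis by (simp add: prime_in_def)
qed

lemma poly_contraction_subset:
  assumes "ideal_in (mpolys V) Q" "z \<in> V"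
  shows "poly_contraction V z Q \<subseteq> Q"
  using poly_in_ideal[OF is_subring_mpolys assms(1) _ var_in_mpolys[OF assms(2)]]
  by (force simp: poly_contraction_def)

text \<open>Krull's argument: an ideal that is maximal among those containing \<open>I\<close> and
  disjoint from \<open>M\<close> is prime.\<close>

lemma prime_in_avoiding:
  assumes S: "is_subring S" and I: "ideal_in S I" and M: "1 \<in> M" "M \<subseteq> S" "\<And>a b. a \<in> M \<Longrightarrow> b \<in> M \<Longrightarrow> a * b \<in> M"
    and IM: "I \<inter> M = {}"
  shows "\<exists>P. prime_in S P \<and> I \<subseteq> P \<and> P \<inter> M = {}"
proof -
  define A where "A = {J. ideal_in S J \<and> I \<subseteq> J \<and> J \<inter> M = {}}"
  have "\<exists>U\<in>A. \<forall>X\<in>C. X \<subseteq> U" if C: "subset.chain A C" for C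
  proof (cases "C = {}")
    case True
    then show ?thesis using I IM by (auto simp: A_def)
  next
    case False
    have CA: "C \<subseteq> A" and tot: "\<And>X Y. X \<in> C \<Longrightarrow> Y \<in> C \<Longrightarrow> X \<subseteq> Y \<or> Y \<subseteq> X"
      using C by (auto simp: subset_chain_def)
    have "ideal_in S (\<Union>C)"
      unfolding ideal_in_def
    proof (intro conjI ballI)
      show "\<Union>C \<subseteq> S" using CA by (auto simp: A_def ideal_in_def)
      show "0 \<in> \<Union>C" using False CA by (auto simp: A_def ideal_in_def)
    next
      fix a b assume "a \<in> \<Union>C" "b \<in> \<Union>C"
      then obtain X Y where XY: "X \<in> C" "Y \<in> C" "a \<in> X" "b \<in> Y" by blast
      then obtain Z where "Z \<in> C" "a \<in> Z" "b \<in> Z" using tot[of X Y] by blast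
      moreover have "ideal_in S Z" using \<open>Z \<in> C\<close> CA by (auto simp: A_def)
      ultimately show "a + b \<in> \<Union>C" using ideal_inD(3) by blast
    next
      fix s a assume "s \<in> S" "a \<in> \<Union>C"
      then obtain Z where "Z \<in> C" "a \<in> Z" by blast
      moreover have "ideal_in S Z" using \<open>Z \<in> C\<close> CA by (auto simp: A_def)
      ultimately show "s * a \<in> \<Union>C" using ideal_inD(4) \<open>s \<in> S\<close> by blast
    qed
    then have "\<Union>C \<in> A" using CA False by (auto simp: A_def)
    then show ?thesis by blast
  qed
  then have "\<exists>P\<in>A. \<forall>X\<in>A. P \<subseteq> X \<longrightarrow> X = P" by (rule subset_Zorn)
  then obtain P where PA: "P \<in> A" and P_max: "\<And>X. X \<in> A \<Longrightarrow> P \<subseteq> X \<Longrightarrow> X = P"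
    by blast
  have P: "ideal_in S P" "I \<subseteq> P" "P \<inter> M = {}" using PA by (auto simp: A_def)
  \<comment> \<open>By maximality, the ideal generated by \<open>P\<close> and an element outside
    \<open>P\<close> meets \<open>M\<close>.\<close>
  have meet: "\<exists>m\<in>M. \<exists>q\<in>P. \<exists>s\<in>S. m = q + s * a" if a: "a \<in> S" "a \<notin> P" for a
  proof (rule ccontr)
    assume neg: "\<not> ?thesis"
    let ?J = "{q + s * a | q s. q \<in> P \<and> s \<in> S}"
    have "ideal_in S ?J"
      unfolding ideal_in_def
    proof (intro conjI ballI)
      show "?J \<subseteq> S" using a ideal_inD(1)[OF P(1)] is_subringD(4,6)[OF S] by blast
      have "0 + 0 * a \<in> ?J" using is_subringD(1)[OF S] ideal_inD(2)[OF P(1)] by blast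
      then show "0 \<in> ?J" by simp
    next
      fix x y assume "x \<in> ?J" "y \<in> ?J"
      then obtain q s q' s' where "x = q + s * a" "y = q' + s' * a" "q \<in> P" "q' \<in> P" "s \<in> S" "s' \<in> S" by blast
      then have "x + y = (q + q') + (s + s') * a" and "q + q' \<in> P" and "s + s' \<in> S"
        by (simp_all add: algebra_simps ideal_inD(3)[OF P(1)] is_subringD(4)[OF S])
      then show "x + y \<in> ?J" by blast
    next
      fix t x assume t: "t \<in> S" and "x \<in> ?J"
      then obtain q s where "x = q + s * a" "q \<in> P" "s \<in> S" by blast
      then have "t * x = t * q + (t * s) * a" and "t * q \<in> P" and "t * s \<in> S"
        using ideal_inD(4)[OF P(1) t] is_subringD(6)[OF S t] by (simp_all only: distrib_left mult.assoc)
      then show "t * x \<in> ?J" by blast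
    qed
    moreover have PJ: "P \<subseteq> ?J"
    proof
      fix q assume "q \<in> P"
      then have "q + 0 * a \<in> ?J" using is_subringD(1)[OF S] by blast
      then show "q \<in> ?J" by simp
    qed
    ultimately have "?J \<in> A" using neg P(2) by (auto simp: A_def)
    then have "?J = P" using P_max PJ by blast
    moreover have "0 + 1 * a \<in> ?J" using is_subringD(2)[OF S] ideal_inD(2)[OF P(1)] by blast
    ultimately show False using a by simp
  qed
  have "a \<in> P \<or> b \<in> P" if ab: "a \<in> S" "b \<in> S" "a * b \<in> P" for a b
  proof (rule ccontr)
    assume "\<not> ?thesis"
    then have ab_P: "a \<notin> P" "b \<notin> P" by auto
    obtain m q s where 1: "m \<in> M" "q \<in> P" "s \<in> S" "m = q + s * a"
      using meet[OF ab(1) ab_P(1)] by auto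
    obtain m' q' s' where 2: "m' \<in> M" "q' \<in> P" "s' \<in> S" "m' = q' + s' * b"
      using meet[OF ab(2) ab_P(2)] by auto
    note * = 1 2
    have "m * m' = q * m' + s * a * q' + (s * s') * (a * b)"
      unfolding *(4) *(8) by (simp add: algebra_simps)
    also have "\<dots> \<in> P"
    proof (intro ideal_inD(3)[OF P(1)])
      show "q * m' \<in> P" using ideal_inD(5)[OF P(1)] * M(2) by blast
      show "s * a * q' \<in> P" using ideal_inD(4)[OF P(1)] is_subringD(6)[OF S] * ab by blast
      show "s * s' * (a * b) \<in> P" using ideal_inD(4)[OF P(1)] is_subringD(6)[OF S] * ab by blast
    qed
    finally show False using M(3)[OF *(1,5)] P(3) by blast
  qed
  then have "prime_in S P"
    using P M(1) by (auto simp: prime_in_def)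
  then show ?thesis using P by blast
qed

section \<open>Heights of ideals in polynomial rings\<close>

lemma ideal_poly_ring_iff:
  fixes I :: "('v, 'k::comm_ring_1) mpoly set"
  shows "ideal I (poly_ring V) \<longleftrightarrow> ideal_in (mpolys V) I"
proof -
  interpret R: cring "poly_ring V :: ('v, 'k) mpoly ring" by (rule cring_poly_ring)
  show ?thesis
  proof
    assume "ideal I (poly_ring V)"
    then interpret I: ideal I "poly_ring V" .
    show "ideal_in (mpolys V) I"
      using I.a_subset I.zero_closed I.a_closed I.I_l_closed by (auto simp: ideal_in_def)
  next
    assume I: "ideal_in (mpolys V) I"
    show "ideal I (poly_ring V)"
    proof (rule idealI)
      show "ring (poly_ring V :: ('v, 'k) mpoly ring)" by (rule R.ring_axioms)
      show "subgroup I (add_monoid (poly_ring V))"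
      proof (rule R.add.subgroupI)
        show "I \<subseteq> mpolys V" using ideal_inD(1)[OF I] by blast
        show "I \<noteq> {}" using ideal_inD(2)[OF I] by blast
      next
        fix a assume a: "a \<in> I"
        have aS: "a \<in> mpolys V" using ideal_inD(1)[OF I a] .
        have "- a \<in> I" using ideal_in_diff[OF I is_subring_mpolys ideal_inD(2)[OF I] a] by simp
        moreover have "\<ominus>\<^bsub>poly_ring V\<^esub> a = - a"
          using R.minus_equality[of "- a" a] aS by simp
        ultimately show "\<ominus>\<^bsub>poly_ring V\<^esub> a \<in> I" by simp
      next
        fix a b assume "a \<in> I" "b \<in> I"
        then show "a \<oplus>\<^bsub>poly_ring V\<^esub> b \<in> I" using ideal_inD(3)[OF I] by simp
      qed
    next
      fix a x :: "('v, 'k) mpoly" assume "a \<in> I" "x \<in> mpolys V"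
      then show "x \<otimes>\<^bsub>poly_ring V\<^esub> a \<in> I" "a \<otimes>\<^bsub>poly_ring V\<^esub> x \<in> I"
        using ideal_inD(4,5)[OF I] by simp_all
    qed
  qed
qed

lemma primeideal_poly_ring_iff:
  fixes P :: "('v, 'k::comm_ring_1) mpoly set"
  shows "primeideal P (poly_ring V) \<longleftrightarrow> prime_in (mpolys V) P"
proof
  assume "primeideal P (poly_ring V)"
  then interpret P: primeideal P "poly_ring V" .
  have "1 \<notin> P"
    using P.one_imp_carrier P.I_notcarr by auto
  then show "prime_in (mpolys V) P"
    using P.is_ideal P.I_prime by (auto simp: prime_in_def ideal_poly_ring_iff)
next
  assume P: "prime_in (mpolys V) P"
  show "primeideal P (poly_ring V)"
  proof (rule primeidealI)
    show "ideal P (poly_ring V)" using prime_inD(1)[OF P] by (simp add: ideal_poly_ring_iff)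
    show "mpolys V \<noteq> P" using prime_inD(2)[OF P] by auto
    show "a \<in> P \<or> b \<in> P" if "a \<in> mpolys V" "b \<in> mpolys V" "a \<otimes>\<^bsub>poly_ring V\<^esub> b \<in> P" for a b
      using prime_inD(3)[OF P that(1,2)] that(3) by simp
  qed (rule cring_poly_ring)
qed

lemma genideal_ideal_in:
  fixes B :: "('v, 'k::comm_ring_1) mpoly set"
  assumes "B \<subseteq> mpolys V"
  shows "ideal_in (mpolys V) (genideal (poly_ring V) B)" "B \<subseteq> genideal (poly_ring V) B"
    "\<And>I. ideal_in (mpolys V) I \<Longrightarrow> B \<subseteq> I \<Longrightarrow> genideal (poly_ring V) B \<subseteq> I"
proof -
  interpret R: cring "poly_ring V :: ('v, 'k) mpoly ring" by (rule cring_poly_ring)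
  show "ideal_in (mpolys V) (genideal (poly_ring V) B)" "B \<subseteq> genideal (poly_ring V) B"
    "\<And>I. ideal_in (mpolys V) I \<Longrightarrow> B \<subseteq> I \<Longrightarrow> genideal (poly_ring V) B \<subseteq> I"
    using R.genideal_ideal[OF assms] R.genideal_self[OF assms] R.genideal_minimal
    by (auto simp: ideal_poly_ring_iff)
qed

text \<open>\<open>indep_mod P W\<close>: the variables in \<open>W\<close> are algebraically independent modulo \<open>P\<close>.\<close>

definition indep_mod :: "('v, 'k::comm_ring_1) mpoly set \<Rightarrow> 'v set \<Rightarrow> bool" where
  "indep_mod P W \<longleftrightarrow> P \<inter> mpolys W \<subseteq> {0}"

text \<open>If every further variable were algebraic over k[W] modulo \<open>P\<close>,
  \<open>eliminate_element\<close> would remove the variables outside \<open>W\<close> one by one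
  from an element of \<open>Q - P\<close>, leaving a nonzero element of \<open>Q\<close> in k[W].
  This stands for the strict drop of transcendence degree.\<close>

lemma indep_mod_extend:
  fixes P Q :: "('v, 'k::comm_ring_1) mpoly set"
  assumes V: "finite V" "W \<subseteq> V" and P: "prime_in (mpolys V) P" and Q: "prime_in (mpolys V) Q"
    and PQ: "P \<subset> Q" and W: "indep_mod Q W"
  shows "\<exists>z\<in>V - W. indep_mod P (insert z W)"
proof (rule ccontr)
  assume neg: "\<not> ?thesis"
  have elim: "(Q - P) \<inter> mpolys W \<noteq> {}"
    if "finite T" "T \<subseteq> V - W" "(Q - P) \<inter> mpolys (W \<union> T) \<noteq> {}" for T
    using that
  proof (induction T rule: finite_induct)
    case (insert z T)
    have z: "z \<in> V" "z \<notin> W" using insert.prems by auto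
    obtain f where f: "f \<in> Q - P" "f \<in> mpolys (W \<union> insert z T)" using insert.prems by blast
    obtain g where g: "g \<in> P" "g \<in> mpolys (insert z W)" "g \<noteq> 0"
      using neg z by (auto simp: indep_mod_def)
    have "mpolys (W \<union> T) \<inter> (Q - P) \<noteq> {}"
    proof (rule eliminate_element[OF is_subring_mpolys is_subring_mpolys _ var_in_mpolys[OF z(1)] P Q])
      show "mpolys (W \<union> T) \<subseteq> (mpolys V :: ('v, 'k) mpoly set)"
        using insert.prems V by (intro mpolys_mono) auto
      show "P \<subseteq> Q" using PQ by blast
      show "coeffs_in (mpolys (W \<union> T)) (isolate z f)"
        using coeff_isolate[OF f(2), of z] mpolys_mono[of "W \<union> insert z T - {z}" "W \<union> T"]
        by (auto simp: coeffs_in_def)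
      show "poly (isolate z f) (var z) \<in> Q - P" using f by simp
      show "poly (isolate z g) (var z) \<in> P" using g by simp
      have gW: "coeff (isolate z g) i \<in> mpolys W" for i
        using coeff_isolate[OF g(2), of z] z by auto
      then show "coeffs_in (mpolys (W \<union> T)) (isolate z g)"
        using mpolys_mono[of W "W \<union> T"] by (auto simp: coeffs_in_def)
      \<comment> \<open>The coefficients lie in k[W], where \<open>Q\<close>, and so
        \<open>P\<close>, contains only 0; if they were in \<open>P\<close>, \<open>g\<close> would
        vanish.\<close>
      show "\<not> coeffs_in P (isolate z g)"
      proof
        assume "coeffs_in P (isolate z g)"
        then have "coeff (isolate z g) i = 0" for i
          using gW[of i] W PQ by (auto simp: coeffs_in_def indep_mod_def)
        then have "isolate z g = 0" by (simp add: poly_eq_iff)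
        then have "poly (isolate z g) (var z) = 0" by simp
        then show False using g(3) by simp
      qed
    qed
    then show ?case using insert by auto
  qed simp
  have "W \<union> (V - W) = V" using V by auto
  then have "(Q - P) \<inter> mpolys (W \<union> (V - W)) \<noteq> {}"
    using PQ ideal_inD(1)[OF prime_inD(1)[OF Q]] by auto
  then have "(Q - P) \<inter> mpolys W \<noteq> {}" using elim[of "V - W"] V by auto
  then show False
    using W ideal_inD(2)[OF prime_inD(1)[OF P]] by (auto simp: indep_mod_def)
qed

text \<open>Descending the chain, each strict inclusion adds one variable to \<open>W\<close> by
  \<open>indep_mod_extend\<close>.\<close>

lemma prime_chain_bound:
  fixes C :: "nat \<Rightarrow> ('v, 'k::comm_ring_1) mpoly set"
  assumes "finite V" "W \<subseteq> V" "\<forall>i\<le>r. prime_in (mpolys V) (C i)" "\<forall>i<r. C i \<subset> C (Suc i)"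
    "indep_mod (C r) W"
  shows "card W + r \<le> card V"
  using assms(2-)
proof (induction r arbitrary: W)
  case 0
  then show ?case using assms(1) by (simp add: card_mono)
next
  case (Suc r)
  then obtain z where z: "z \<in> V - W" "indep_mod (C r) (insert z W)"
    using indep_mod_extend[OF assms(1), of W "C r" "C (Suc r)"] by auto
  then have "card (insert z W) + r \<le> card V"
    using Suc.prems by (intro Suc.IH) auto
  moreover have "finite W" using Suc.prems assms(1) finite_subset by blast
  ultimately show ?case using z by simp
qed

lemma prime_height_le:
  fixes P :: "('v, 'k::comm_ring_1) mpoly set"
  assumes "finite V" "W \<subseteq> V" "indep_mod P W"
  shows "prime_height (poly_ring V) P \<le> enat (card V - card W)"
  unfolding prime_height_def
proof (rule Sup_least)
  fix x
  assume "x \<in> {enat r |r. \<exists>C. (\<forall>i\<le>r. primeideal (C i) (poly_ring V)) \<and> (\<forall>i<r. C i \<subset> C (Suc i)) \<and> C r = P}"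
  then obtain r C where r: "x = enat r" "\<forall>i\<le>r. prime_in (mpolys V) (C i)" "\<forall>i<r. C i \<subset> C (Suc i)" "C r = P"
    by (auto simp: primeideal_poly_ring_iff)
  then have "card W + r \<le> card V" using prime_chain_bound[OF assms(1,2)] assms(3) by blast
  then show "x \<le> enat (card V - card W)" using r by simp
qed

text \<open>k[W] - {0} is multiplicatively closed because polynomials form a domain (hence the sort
  \<open>linorder\<close>), and a prime over \<open>I\<close> that avoids it keeps \<open>W\<close>
  independent.\<close>

lemma height_le:
  fixes I :: "('v::linorder, 'k::field) mpoly set"
  assumes V: "finite V" "W \<subseteq> V" and I: "ideal_in (mpolys V) I" "indep_mod I W"
  shows "height (poly_ring V) I \<le> enat (card V - card W)"
proof -
  have "I \<inter> (mpolys W - {0}) = {}" using I by (auto simp: indep_mod_def)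
  moreover have "mpolys W - {0} \<subseteq> (mpolys V :: ('v, 'k) mpoly set)"
    using mpolys_mono[OF V(2)] by auto
  ultimately obtain P where P: "prime_in (mpolys V) P" "I \<subseteq> P" "P \<inter> (mpolys W - {0}) = {}"
    using prime_in_avoiding[OF is_subring_mpolys I(1), of "mpolys W - {0}"] by auto
  have "height (poly_ring V) I \<le> prime_height (poly_ring V) P"
    unfolding height_def using P by (intro Inf_lower) (auto simp: primeideal_poly_ring_iff)
  also have "\<dots> \<le> enat (card V - card W)"
    using P by (intro prime_height_le[OF V]) (auto simp: indep_mod_def)
  finally show ?thesis .
qed

text \<open>The chain grows downwards, one step per variable of \<open>T\<close>, by passing from
  the bottom prime to its \<open>poly_contraction\<close>. A relation between \<open>z\<close> and
  \<open>W\<close> lies in the bottom prime but not in the contraction, so the step is strict. The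
  last conjunct keeps such relations available for the variables not yet treated.\<close>

lemma prime_chain_exists:
  fixes P :: "('v, 'k::comm_ring_1) mpoly set"
  assumes "finite T" and V: "W \<subseteq> V" and P: "prime_in (mpolys V) P" and W: "indep_mod P W"
    and max: "\<And>z. z \<in> T \<Longrightarrow> \<not> indep_mod P (insert z W)" and "T \<subseteq> V - W"
  shows "\<exists>C. (\<forall>i\<le>card T. prime_in (mpolys V) (C i)) \<and> (\<forall>i<card T. C i \<subset> C (Suc i)) \<and>
     C (card T) = P \<and> C 0 \<subseteq> P \<and> P \<inter> mpolys (V - T) \<subseteq> C 0"
  using assms(1) max assms(6)
proof (induction T rule: finite_induct)
  case empty
  then show ?case using P by (intro exI[of _ "\<lambda>_. P"]) auto
next
  case (insert z T)
  then obtain C where C: "\<And>i. i \<le> card T \<Longrightarrow> prime_in (mpolys V) (C i)"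
      "\<And>i. i < card T \<Longrightarrow> C i \<subset> C (Suc i)"
      "C (card T) = P" "C 0 \<subseteq> P" "P \<inter> mpolys (V - T) \<subseteq> C 0"
    by auto
  have z: "z \<in> V" "z \<notin> W" using insert.prems by auto
  define Q where "Q = poly_contraction V z (C 0)"
  define C' where "C' i = (case i of 0 \<Rightarrow> Q | Suc i \<Rightarrow> C i)" for i
  have Q: "prime_in (mpolys V) Q" unfolding Q_def by (intro prime_in_poly_contraction C) simp
  have QC: "Q \<subseteq> C 0"
    unfolding Q_def using C(1)[of 0] by (intro poly_contraction_subset prime_inD z) simp
  obtain g where g: "g \<in> P" "g \<in> mpolys (insert z W)" "g \<noteq> 0"
    using insert.prems(1)[of z] by (auto simp: indep_mod_def)
  have "g \<in> mpolys (V - T)"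
    using g(2) mpolys_mono[of "insert z W" "V - T"] insert.prems insert.hyps V by blast
  then have gC: "g \<in> C 0" using C g by blast
  have "g \<notin> Q"
  proof
    assume "g \<in> Q"
    then have "coeff (isolate z g) i \<in> P" for i
      using C(4) by (auto simp: Q_def poly_contraction_def coeffs_in_def)
    moreover have "coeff (isolate z g) i \<in> mpolys W" for i
      using coeff_isolate[OF g(2), of z] z by auto
    ultimately have "coeff (isolate z g) i = 0" for i
      using W by (auto simp: indep_mod_def)
    then have "isolate z g = 0" by (simp add: poly_eq_iff)
    then have "poly (isolate z g) (var z) = 0" by simp
    then show False using g(3) by simp
  qed
  with gC QC have "Q \<subset> C 0" by blast
  then have "C' i \<subset> C' (Suc i)" if "i < card (insert z T)" for i
    using that C(2) insert.hyps by (auto simp: C'_def split: nat.split)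
  moreover have "prime_in (mpolys V) (C' i)" if "i \<le> card (insert z T)" for i
    using that C(1) Q insert.hyps by (auto simp: C'_def split: nat.split)
  moreover have "P \<inter> mpolys (V - insert z T) \<subseteq> C' 0"
  proof
    fix f assume f: "f \<in> P \<inter> mpolys (V - insert z T)"
    have "f \<in> mpolys (V - T)" using f mpolys_mono[of "V - insert z T" "V - T"] by blast
    then have "f \<in> C 0" using f C by blast
    moreover have "isolate z f = [:f:]" using f isolate_free[of f "V - insert z T" z] by simp
    moreover have "f \<in> mpolys V" using f ideal_inD(1)[OF prime_inD(1)[OF P]] by blast
    moreover have "0 \<in> C 0" using C(1)[of 0] prime_inD(1) ideal_inD(2) by blast
    ultimately show "f \<in> C' 0"
      by (auto simp: C'_def Q_def poly_contraction_def coeffs_in_def coeff_pCons split: nat.split)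
  qed
  ultimately show ?case
    using C QC insert.hyps by (intro exI[of _ C']) (auto simp: C'_def)
qed

text \<open>If \<open>W\<close> is maximal with respect to inclusion, every other variable is
  dependent on it, and \<open>prime_chain_exists\<close> gives a chain with one step for each of
  them.\<close>

lemma height_ge:
  fixes I :: "('v, 'k::field) mpoly set"
  assumes V: "finite V"
    and bound: "\<And>P W. prime_in (mpolys V) P \<Longrightarrow> I \<subseteq> P \<Longrightarrow> W \<subseteq> V \<Longrightarrow> indep_mod P W \<Longrightarrow> card W \<le> d"
  shows "enat (card V - d) \<le> height (poly_ring V) I"
  unfolding height_def
proof (rule Inf_greatest)
  fix x assume "x \<in> {prime_height (poly_ring V) P |P. primeideal P (poly_ring V) \<and> I \<subseteq> P}"
  then obtain P where x: "x = prime_height (poly_ring V) P" and P: "prime_in (mpolys V) P" and IP: "I \<subseteq> P"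
    by (auto simp: primeideal_poly_ring_iff)
  \<comment> \<open>Nonzero constants are units, so the empty set is independent and a maximal
    independent set exists.\<close>
  have "indep_mod P {}"
    unfolding indep_mod_def
  proof
    fix p assume p: "p \<in> P \<inter> mpolys {}"
    define a where "a = Poly_Mapping.lookup p 0"
    have pa: "p = Const a" unfolding a_def using p by (intro mpolys_empty) auto
    have "Const (1 / a) * p \<in> P"
      using p by (intro ideal_inD(4)[OF prime_inD(1)[OF P]]) auto
    then have "a = 0"
      using prime_inD(2)[OF P] pa by (auto simp: mult_single split: if_splits)
    then show "p \<in> {0}" using pa by simp
  qed
  moreover have "finite {W. W \<subseteq> V \<and> indep_mod P W}" using V by simp
  ultimately have "\<exists>W\<in>{W. W \<subseteq> V \<and> indep_mod P W}. \<forall>U\<in>{W. W \<subseteq> V \<and> indep_mod P W}. W \<subseteq> U \<longrightarrow> W = U"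
    by (intro finite_has_maximal) auto
  then obtain W where W: "W \<subseteq> V" "indep_mod P W"
    and W_max: "\<And>U. U \<subseteq> V \<Longrightarrow> indep_mod P U \<Longrightarrow> W \<subseteq> U \<Longrightarrow> W = U"
    by auto
  have "\<not> indep_mod P (insert z W)" if "z \<in> V - W" for z
    using W_max[of "insert z W"] W that by auto
  then obtain C where C: "\<forall>i\<le>card (V - W). prime_in (mpolys V) (C i)"
      "\<forall>i<card (V - W). C i \<subset> C (Suc i)" "C (card (V - W)) = P"
    using prime_chain_exists[of "V - W" W V P] V W P by auto
  have "enat (card V - d) \<le> enat (card (V - W))"
    using bound[OF P IP W] V W by (simp add: card_Diff_subset finite_subset)
  also have "\<dots> \<le> x"
    unfolding x prime_height_def using C
    by (intro Sup_upper) (auto simp: primeideal_poly_ring_iff)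
  finally show "enat (card V - d) \<le> x" .
qed

section \<open>Numbers of generators\<close>

text \<open>With every v replaced by v t, the homogeneous component of degree d is the coefficient
  of t^d, and its product rule is that of \<open>coeff\<close>.\<close>

definition hcomp :: "nat \<Rightarrow> ('v, 'k::comm_ring_1) mpoly \<Rightarrow> ('v, 'k) mpoly" where
  "hcomp d p = coeff (subst (\<lambda>v. [:0, var v:]) p) d"

lemma hcomp_simps [simp]: "hcomp d (p + q) = hcomp d p + hcomp d q" "hcomp d 0 = 0"
  by (simp_all add: hcomp_def)

lemma hcomp_mult: "hcomp d (p * q) = (\<Sum>i\<le>d. hcomp i p * hcomp (d - i) q)"
  by (simp add: hcomp_def coeff_mult)

lemma lookup_hcomp:
  fixes p :: "('v, 'k::comm_ring_1) mpoly"
  shows "Poly_Mapping.lookup (hcomp d p) m = (if mdegree m = d then Poly_Mapping.lookup p m else 0)"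
proof -
  let ?G = "subst (\<lambda>v. [:0, var v:]) :: ('v, 'k) mpoly \<Rightarrow> ('v, 'k) mpoly poly"
  have "p \<in> mpolys UNIV" by (simp add: mpolys_iff)
  then have deg: "\<forall>m\<in>Poly_Mapping.keys (coeff (?G p) i). mdegree m = i" for i
  proof (induction p arbitrary: i rule: mpolys_induct)
    case (Const a)
    then show ?case by (auto simp: coeff_pCons split: nat.splits if_splits)
  next
    case (var p v)
    show ?case
    proof (cases i)
      case (Suc j)
      have "Poly_Mapping.keys (var v * coeff (?G p) j) \<subseteq>
          {a + b |a b. a \<in> Poly_Mapping.keys (var v :: ('v, 'k) mpoly) \<and> b \<in> Poly_Mapping.keys (coeff (?G p) j)}"
        by (rule keys_mult)
      moreover have "Poly_Mapping.keys (var v :: ('v, 'k) mpoly) \<subseteq> {Poly_Mapping.single v 1}"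
        by (simp add: var_def)
      ultimately have "\<forall>m\<in>Poly_Mapping.keys (var v * coeff (?G p) j). mdegree m = Suc j"
        using var.IH[of j] by (fastforce simp: mdegree_add)
      then show ?thesis using Suc by simp
    qed simp
  next
    case (add p q)
    then show ?case using Poly_Mapping.keys_add[of "coeff (?G p) i" "coeff (?G q) i"] by auto
  qed
  \<comment> \<open>Setting t = 1 undoes the substitution, so \<open>p\<close> is the sum of the
    coefficients, and only one of them can contain the monomial \<open>m\<close>.\<close>
  have one: "poly (?G p) 1 = p" using \<open>p \<in> mpolys UNIV\<close>
    by (induction p rule: mpolys_induct) auto
  have zero: "Poly_Mapping.lookup (coeff (?G p) i) m = 0" if "i \<noteq> mdegree m" for i
    using deg[of i] that by (auto simp: in_keys_iff)
  have "Poly_Mapping.lookup p m = (\<Sum>i\<le>degree (?G p). Poly_Mapping.lookup (coeff (?G p) i) m)"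
    by (subst one[symmetric]) (simp add: poly_altdef lookup_sum)
  also have "\<dots> = (\<Sum>i\<le>degree (?G p). if i = mdegree m then Poly_Mapping.lookup (coeff (?G p) i) m else 0)"
    by (intro sum.cong refl) (simp add: zero)
  also have "\<dots> = Poly_Mapping.lookup (coeff (?G p) (mdegree m)) m"
    by (auto simp: coeff_eq_0)
  finally show ?thesis using zero[of d] by (auto simp: hcomp_def)
qed

lemma mdegree_eq_0_iff: "mdegree m = 0 \<longleftrightarrow> m = 0"
  by (auto simp: mdegree_def in_keys_iff intro: poly_mapping_eqI)

lemma hcomp_0: "hcomp 0 p = Const (Poly_Mapping.lookup p 0)"
proof (rule poly_mapping_eqI)
  fix m show "Poly_Mapping.lookup (hcomp 0 p) m = Poly_Mapping.lookup (Const (Poly_Mapping.lookup p 0)) m"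
    by (cases "m = 0") (simp_all add: lookup_hcomp lookup_single_not_eq mdegree_eq_0_iff)
qed

lemma hcomp_eq_self_iff: "hcomp d p = p \<longleftrightarrow> (\<forall>m\<in>Poly_Mapping.keys p. mdegree m = d)"
  unfolding poly_mapping_eq_iff fun_eq_iff lookup_hcomp Ball_def in_keys_iff by metis

lemma homogeneous_iff_hcomp: "homogeneous p \<longleftrightarrow> (\<exists>d. hcomp d p = p)"
  by (simp add: homogeneous_def hcomp_eq_self_iff)

lemma hcomp_hcomp: "hcomp i (hcomp d p) = (if i = d then hcomp d p else 0)"
  by (intro poly_mapping_eqI) (simp add: lookup_hcomp)

section \<open>Graded Nakayama for an ideal generated in one degree\<close>

interpretation mpoly_vs: vector_space "\<lambda>(a::'k::field) (p::('v, 'k) mpoly). Const a * p"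
  by unfold_locales (simp_all add: algebra_simps single_add mult_single flip: mult.assoc)

lemma span_subset_ideal:
  assumes "ideal_in (mpolys V) I" "B \<subseteq> I"
  shows "mpoly_vs.span B \<subseteq> I"
proof (rule mpoly_vs.span_minimal[OF assms(2)])
  show "mpoly_vs.subspace I"
    using ideal_inD(2,3,4)[OF assms(1)] by (auto intro!: mpoly_vs.subspaceI)
qed

text \<open>If \<open>f\<close> has no component below degree d, multiplication by \<open>s\<close>
  acts on its component of degree d through the constant term of \<open>s\<close> only. So
  generators taken from this set produce nothing outside the span in degree d.\<close>

lemma ideal_in_initial_span:
  fixes F :: "('v, 'k::field) mpoly set"
  shows "ideal_in (mpolys V) {f \<in> mpolys V. (\<forall>i<d. hcomp i f = 0) \<and> hcomp d f \<in> mpoly_vs.span F}"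
    (is "ideal_in _ ?J")
  unfolding ideal_in_def
proof (intro conjI ballI)
  fix s f :: "('v, 'k) mpoly" assume s: "s \<in> mpolys V" and f: "f \<in> ?J"
  have "hcomp i (s * f) = 0" if "i < d" for i
    unfolding hcomp_mult using f that by (intro sum.neutral) auto
  moreover have "hcomp d (s * f) = hcomp 0 s * hcomp d f"
  proof -
    have "hcomp d (s * f) = (\<Sum>i\<le>d. if i = 0 then hcomp 0 s * hcomp d f else 0)"
      unfolding hcomp_mult using f by (intro sum.cong) auto
    then show ?thesis by simp
  qed
  ultimately show "s * f \<in> ?J"
    using s f by (auto simp: hcomp_0 intro: mpoly_vs.span_scale)
qed (auto intro: mpoly_vs.span_add mpoly_vs.span_zero)

context
  fixes V :: "'v set" and F :: "('v, 'k::field) mpoly set" and d :: nat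
  assumes F: "F \<subseteq> mpolys V" and hom_F: "\<And>f. f \<in> F \<Longrightarrow> hcomp d f = f"
begin

private abbreviation "I \<equiv> genideal (poly_ring V) F"

lemma hom_gen_set_if_span:
  assumes "B \<subseteq> I" "\<And>b. b \<in> B \<Longrightarrow> homogeneous b" "F \<subseteq> mpoly_vs.span B"
  shows "hom_gen_set V I B"
proof -
  have B: "B \<subseteq> mpolys V" using assms(1) ideal_inD(1)[OF genideal_ideal_in(1)[OF F]] by blast
  have "genideal (poly_ring V) B \<subseteq> I"
    by (rule genideal_ideal_in(3)[OF B genideal_ideal_in(1)[OF F] assms(1)])
  moreover have "mpoly_vs.span B \<subseteq> genideal (poly_ring V) B"
    by (rule span_subset_ideal[OF genideal_ideal_in(1)[OF B] genideal_ideal_in(2)[OF B]])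
  then have "I \<subseteq> genideal (poly_ring V) B"
    using assms(3) by (intro genideal_ideal_in(3)[OF F genideal_ideal_in(1)[OF B]]) blast
  ultimately show ?thesis using B assms(2) by (auto simp: hom_gen_set_def)
qed

text \<open>\<open>ideal_in_initial_span\<close> is used twice: with \<open>F\<close> it bounds the
  part of \<open>I\<close> in degree d, with \<open>B'\<close> it shows that members of
  \<open>B\<close> of other degrees contribute nothing there.\<close>

lemma span_of_hom_gen_set:
  assumes B: "hom_gen_set V I B"
  defines "B' \<equiv> {b \<in> B. hcomp d b = b}"
  shows "mpoly_vs.span B' = mpoly_vs.span F"
proof -
  let ?J = "\<lambda>F. {f \<in> mpolys V. (\<forall>i<d. hcomp i f = 0) \<and> hcomp d f \<in> mpoly_vs.span F}"
  have BV: "B \<subseteq> mpolys V" and BI: "genideal (poly_ring V) B = I" and hom: "\<And>b. b \<in> B \<Longrightarrow> homogeneous b"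
    using B by (auto simp: hom_gen_set_def)
  have "hcomp i f = 0" if "f \<in> F" "i < d" for f i
    using hcomp_hcomp[of i d f] hom_F[OF that(1)] that(2) by simp
  then have "I \<subseteq> ?J F"
    using F hom_F by (intro genideal_ideal_in(3)[OF F ideal_in_initial_span]) (auto intro: mpoly_vs.span_base)
  then have BJ: "B \<subseteq> ?J F" using BI genideal_ideal_in(2)[OF BV] by blast
  then have "B' \<subseteq> mpoly_vs.span F" unfolding B'_def by force
  moreover have "B \<subseteq> ?J B'"
  proof
    fix b assume b: "b \<in> B"
    then obtain e where e: "hcomp e b = b" using hom by (auto simp: homogeneous_iff_hcomp)
    have i: "hcomp i b = (if i = e then b else 0)" for i using hcomp_hcomp[of i e b] e by simp
    have "hcomp d b \<in> mpoly_vs.span B'"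
    proof (cases "d = e")
      case True
      then have "b \<in> B'" using b e by (simp add: B'_def)
      then show ?thesis using True e by (auto intro: mpoly_vs.span_base)
    qed (simp add: i mpoly_vs.span_zero)
    then show "b \<in> ?J B'" using b BJ by auto
  qed
  then have "I \<subseteq> ?J B'"
    unfolding BI[symmetric] by (rule genideal_ideal_in(3)[OF BV ideal_in_initial_span])
  then have "F \<subseteq> mpoly_vs.span B'"
    using genideal_ideal_in(2)[OF F] hom_F by force
  ultimately show ?thesis by (metis mpoly_vs.span_eq)
qed

text \<open>Minimal homogeneous generating sets are bases of the span of \<open>F\<close>, so
  invariance of dimension settles the definite description in \<open>num_gens\<close>.\<close>

lemma num_gens_eq_card:
  assumes ind: "mpoly_vs.independent F"
  shows "homogeneous_ideal V I" "num_gens V I = card F"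
proof -
  have hom: "homogeneous f" if "f \<in> F" for f using hom_F[OF that] by (auto simp: homogeneous_iff_hcomp)
  have gF: "hom_gen_set V I F"
    using hom genideal_ideal_in(2)[OF F] by (intro hom_gen_set_if_span) (auto intro: mpoly_vs.span_base)
  show "homogeneous_ideal V I"
    using gF genideal_ideal_in(1)[OF F] by (auto simp: homogeneous_ideal_def ideal_poly_ring_iff)
  have min: "minimal_hom_gen_set V I F"
    unfolding minimal_hom_gen_set_def
  proof (intro conjI allI impI notI gF)
    fix B assume B: "B \<subset> F" "hom_gen_set V I B"
    then obtain f where f: "f \<in> F" "f \<notin> B" by blast
    have "f \<in> mpoly_vs.span {b \<in> B. hcomp d b = b}"
      using span_of_hom_gen_set[OF B(2)] f by (simp add: mpoly_vs.span_base)
    moreover have "{b \<in> B. hcomp d b = b} \<subseteq> F - {f}" using B f by auto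
    ultimately have "f \<in> mpoly_vs.span (F - {f})" using mpoly_vs.span_mono by blast
    then show False using ind f by (auto simp: mpoly_vs.dependent_def)
  qed
  have unique: "card B = card F" if B: "minimal_hom_gen_set V I B" for B
  proof -
    have gB: "hom_gen_set V I B" and B_min: "\<And>B'. B' \<subset> B \<Longrightarrow> \<not> hom_gen_set V I B'"
      using B by (auto simp: minimal_hom_gen_set_def)
    have hB: "\<And>b. b \<in> B \<Longrightarrow> homogeneous b" and BI: "B \<subseteq> I"
      using gB genideal_ideal_in(2)[of B V] unfolding hom_gen_set_def by blast+
    \<comment> \<open>A subset whose span contains \<open>F\<close> still generates
      \<open>I\<close>, so it cannot be proper. This is applied to the members of degree d and to
      \<open>B\<close> without one element.\<close>
    have sub: "B' = B" if "B' \<subseteq> B" "F \<subseteq> mpoly_vs.span B'" for B'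
    proof (rule ccontr)
      assume "B' \<noteq> B"
      then have "\<not> hom_gen_set V I B'" using that by (intro B_min) auto
      moreover have "hom_gen_set V I B'"
        using that(1) BI hB by (intro hom_gen_set_if_span[OF _ _ that(2)]) blast+
      ultimately show False by contradiction
    qed
    have "{b \<in> B. hcomp d b = b} = B"
    proof (rule sub)
      show "F \<subseteq> mpoly_vs.span {b \<in> B. hcomp d b = b}"
        unfolding span_of_hom_gen_set[OF gB] by (rule mpoly_vs.span_superset)
    qed blast
    then have sp: "mpoly_vs.span B = mpoly_vs.span F" using span_of_hom_gen_set[OF gB] by simp
    have "mpoly_vs.independent B"
      unfolding mpoly_vs.dependent_def
    proof (intro notI, elim bexE)
      fix b assume b: "b \<in> B" "b \<in> mpoly_vs.span (B - {b})"
      then have "mpoly_vs.span (B - {b}) = mpoly_vs.span B"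
        using mpoly_vs.span_redundant[OF b(2)] b(1) by (simp add: insert_absorb)
      then have "F \<subseteq> mpoly_vs.span (B - {b})" using sp mpoly_vs.span_superset[of F] by simp
      then have "B - {b} = B" by (intro sub) auto
      then show False using b(1) by blast
    qed
    then have "mpoly_vs.dim F = card B" by (rule mpoly_vs.dim_eq_card[OF sp])
    then show ?thesis using mpoly_vs.dim_eq_card[OF refl ind] by simp
  qed
  show "num_gens V I = card F"
    unfolding num_gens_def
  proof (rule the_equality)
    show "\<exists>B. minimal_hom_gen_set V I B \<and> card B = card F" using min by blast
    show "m = card F" if "\<exists>B. minimal_hom_gen_set V I B \<and> card B = m" for m
      using that unique by blast
  qed
qed

end

section \<open>Edge ideals\<close>

fun xy_code :: "xy \<Rightarrow> nat" where
  "xy_code (X i) = 2 * i"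
| "xy_code (Y i) = 2 * i + 1"

lemma xy_code_eq_iff: "xy_code a = xy_code b \<longleftrightarrow> a = b"
  by (cases a; cases b) (auto, presburger+)

text \<open>Any linear order on the variables makes the polynomial ring an instance of \<open>idom\<close>.\<close>

instantiation xy :: linorder
begin

definition "a \<le> b \<longleftrightarrow> xy_code a \<le> xy_code b"
definition "a < b \<longleftrightarrow> xy_code a < xy_code b"

instance
  by standard (auto simp: less_eq_xy_def less_xy_def xy_code_eq_iff)

end

lemma card_xy_vars: "finite (xy_vars n)" "card (xy_vars n) = 2 * n"
proof -
  show "finite (xy_vars n)" by (simp add: xy_vars_def)
  have "card (xy_vars n) = card (X ` {1..n}) + card (Y ` {1..n})"
    unfolding xy_vars_def by (rule card_Un_disjoint) auto
  then show "card (xy_vars n) = 2 * n" by (simp add: card_image inj_on_def)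
qed

definition edge_poly :: "'k::field \<Rightarrow> nat \<Rightarrow> nat \<Rightarrow> (xy, 'k) mpoly" where
  "edge_poly c i j = var (X i) * var (X j) + Const c * (var (Y i) * var (Y j))"

definition edge_polys :: "'k::field \<Rightarrow> nat set set \<Rightarrow> (xy, 'k) mpoly set" where
  "edge_polys c E = {edge_poly c i j | i j. {i, j} \<in> E}"

definition edge_ideal :: "'k::field \<Rightarrow> nat \<Rightarrow> nat set set \<Rightarrow> (xy, 'k) mpoly set" where
  "edge_ideal c n E = genideal (poly_ring (xy_vars n)) (edge_polys c E)"

lemma LSS_ideal_eq: "LSS_ideal n E = edge_ideal 1 n E"
  by (simp add: LSS_ideal_def edge_ideal_def edge_polys_def edge_poly_def)

lemma parity_binomial_edge_ideal_eq: "parity_binomial_edge_ideal n E = edge_ideal (-1) n E"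
  by (simp add: parity_binomial_edge_ideal_def edge_ideal_def edge_polys_def edge_poly_def single_uminus)

lemma edge_poly_commute: "edge_poly c i j = edge_poly c j i"
  by (simp add: edge_poly_def mult.commute)

lemma simple_graph_edge:
  assumes "simple_graph V E" "{i, j} \<in> E"
  shows "i \<in> V" "j \<in> V" "i \<noteq> j"
  using assms unfolding simple_graph_def by (fastforce simp: card_insert_if)+

lemma edge_polys_subset:
  assumes "simple_graph {1..n} E"
  shows "edge_polys c E \<subseteq> mpolys (xy_vars n)"
proof
  fix f assume "f \<in> edge_polys c E"
  then obtain i j where f: "f = edge_poly c i j" and ij: "{i, j} \<in> E" by (auto simp: edge_polys_def)
  then have "X i \<in> xy_vars n" "X j \<in> xy_vars n" "Y i \<in> xy_vars n" "Y j \<in> xy_vars n"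
    using simple_graph_edge[OF assms ij] by (auto simp: xy_vars_def)
  then show "f \<in> mpolys (xy_vars n)" by (simp add: f edge_poly_def)
qed

lemma var_mult_var: "var a * var b = Poly_Mapping.single (Poly_Mapping.single a 1 + Poly_Mapping.single b 1) 1"
  by (simp add: var_def mult_single)

lemma edge_poly_eq:
  "edge_poly c i j = Poly_Mapping.single (Poly_Mapping.single (X i) 1 + Poly_Mapping.single (X j) 1) 1 +
     Poly_Mapping.single (Poly_Mapping.single (Y i) 1 + Poly_Mapping.single (Y j) 1) c"
  by (simp add: edge_poly_def var_mult_var mult_single)

lemma hcomp_edge_poly: "hcomp 2 (edge_poly c i j) = edge_poly c i j"
  unfolding hcomp_eq_self_iff edge_poly_eq
  using Poly_Mapping.keys_add[of "Poly_Mapping.single (Poly_Mapping.single (X i) 1 + Poly_Mapping.single (X j) 1) (1::'a)"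
     "Poly_Mapping.single (Poly_Mapping.single (Y i) 1 + Poly_Mapping.single (Y j) 1) c"]
  by (auto simp: mdegree_add simp del: One_nat_def split: if_splits)

lemma single_plus_single_eq_iff:
  assumes "i \<noteq> j" "k \<noteq> l"
  shows "Poly_Mapping.single i (1::nat) + Poly_Mapping.single j 1 = Poly_Mapping.single k 1 + Poly_Mapping.single l 1
    \<longleftrightarrow> {i, j} = {k, l}"
proof
  have keys: "Poly_Mapping.keys (Poly_Mapping.single i (1::nat) + Poly_Mapping.single j 1) = {i, j}" for i j :: 'a
    by (auto simp: in_keys_iff lookup_add lookup_single when_def split: if_splits)
  show "{i, j} = {k, l}" if "Poly_Mapping.single i (1::nat) + Poly_Mapping.single j 1 = Poly_Mapping.single k 1 + Poly_Mapping.single l 1"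
    using arg_cong[OF that, of Poly_Mapping.keys] unfolding keys .
qed (auto simp: doubleton_eq_iff add.commute)

text \<open>The monomial x_i x_j occurs in the generator of the edge {i, j} only; reading off its
  coefficient gives both linear independence and distinctness of the generators.\<close>

lemma lookup_edge_poly:
  assumes "i \<noteq> j" "k \<noteq> l"
  shows "Poly_Mapping.lookup (edge_poly c k l) (Poly_Mapping.single (X i) 1 + Poly_Mapping.single (X j) 1)
    = (if {i, j} = {k, l} then 1 else 0)"
proof -
  have "{X k, X l} = {X i, X j} \<longleftrightarrow> {i, j} = {k, l}" "{Y k, Y l} \<noteq> {X i, X j}"
    by (auto simp: doubleton_eq_iff)
  then show ?thesis
    using assms by (simp add: edge_poly_eq lookup_add lookup_single when_def single_plus_single_eq_iff
        del: insert_iff One_nat_def)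
qed

lemma lookup_Const_mult: "Poly_Mapping.lookup (Const a * p) m = a * Poly_Mapping.lookup p m"
  by (simp add: map.rep_eq when_def flip: mult_map_scale_conv_mult)

lemma independent_edge_polys:
  fixes c :: "'k::field"
  assumes G: "simple_graph V E"
  shows "mpoly_vs.independent (edge_polys c E)"
  unfolding mpoly_vs.dependent_def
proof
  assume "\<exists>f\<in>edge_polys c E. f \<in> mpoly_vs.span (edge_polys c E - {f})"
  then obtain i j where ij: "{i, j} \<in> E"
    and span: "edge_poly c i j \<in> mpoly_vs.span (edge_polys c E - {edge_poly c i j})"
    by (auto simp: edge_polys_def)
  let ?m = "Poly_Mapping.single (X i) 1 + Poly_Mapping.single (X j) (1::nat)"
  let ?S = "{p. Poly_Mapping.lookup p ?m = (0::'k)}"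
  have "mpoly_vs.span (edge_polys c E - {edge_poly c i j}) \<subseteq> ?S"
  proof (rule mpoly_vs.span_minimal)
    show "mpoly_vs.subspace ?S"
      by (rule mpoly_vs.subspaceI)
         (auto simp: lookup_add lookup_Const_mult)
    show "edge_polys c E - {edge_poly c i j} \<subseteq> ?S"
    proof
      fix f assume "f \<in> edge_polys c E - {edge_poly c i j}"
      then obtain k l where kl: "{k, l} \<in> E" "f = edge_poly c k l" "f \<noteq> edge_poly c i j"
        by (auto simp: edge_polys_def)
      then have "{i, j} \<noteq> {k, l}" using edge_poly_commute[of c i j] by (auto simp: doubleton_eq_iff)
      then show "f \<in> ?S"
        using lookup_edge_poly[of i j k l c] simple_graph_edge[OF G ij] simple_graph_edge[OF G kl(1)] kl by simp
    qed
  qed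
  then show False
    using span lookup_edge_poly[of i j i j c] simple_graph_edge[OF G ij] by auto
qed

lemma card_edge_polys:
  assumes G: "simple_graph V E"
  shows "card (edge_polys c E) = card E"
proof -
  \<comment> \<open>\<open>Min\<close> and \<open>Max\<close> orient the edge, which makes the
    generator a function of it.\<close>
  define g where "g e = edge_poly c (Min e) (Max e)" for e
  have g: "g {i, j} = edge_poly c i j" for i j
    using edge_poly_commute[of c i j] by (auto simp: g_def min_def max_def)
  have ex: "\<exists>i j. e = {i, j} \<and> i \<noteq> j" if "e \<in> E" for e
    using G that by (auto simp: simple_graph_def card_2_iff)
  have "edge_polys c E = g ` E"
    using ex by (force simp: edge_polys_def image_iff g simp flip: g)
  moreover have "inj_on g E"
  proof (rule inj_onI)
    fix e e' assume e: "e \<in> E" "e' \<in> E" "g e = g e'"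
    obtain i j where "e = {i, j}" "i \<noteq> j" using ex[OF e(1)] by blast
    moreover obtain k l where "e' = {k, l}" "k \<noteq> l" using ex[OF e(2)] by blast
    ultimately show "e = e'"
      using e(3) lookup_edge_poly[of i j k l c] lookup_edge_poly[of i j i j c] by (auto simp: g split: if_splits)
  qed
  ultimately show ?thesis by (simp add: card_image)
qed

lemma complete_intersection_edge_ideal_iff:
  assumes G: "simple_graph {1..n} E"
  shows "complete_intersection (xy_vars n) (edge_ideal c n E) \<longleftrightarrow>
    enat (card E) = height (poly_ring (xy_vars n)) (edge_ideal c n E)"
proof -
  have h: "hcomp 2 f = f" if "f \<in> edge_polys c E" for f
    using that by (auto simp: edge_polys_def hcomp_edge_poly)
  show ?thesis
    using num_gens_eq_card[OF edge_polys_subset[OF G] h independent_edge_polys[OF G]]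
    by (simp add: complete_intersection_def edge_ideal_def card_edge_polys[OF G])
qed

section \<open>An upper bound for the height\<close>

text \<open>A labelling partitions the vertices into classes, each containing its index, such that the
  edges of \<open>F\<close> lie inside the classes and a class outside \<open>B\<close> is properly \<open>2\<close>-coloured.\<close>

definition labelling :: "'a set \<Rightarrow> 'a set set \<Rightarrow> ('a \<Rightarrow> 'a) \<Rightarrow> ('a \<Rightarrow> bool) \<Rightarrow> 'a set \<Rightarrow> bool" where
  "labelling U F \<rho> col B \<longleftrightarrow>
     (\<forall>i\<in>U. \<rho> i \<in> U \<and> \<rho> (\<rho> i) = \<rho> i \<and> col (\<rho> i)) \<and>
     (\<forall>i j. {i, j} \<in> F \<longrightarrow> \<rho> i = \<rho> j \<and> (\<rho> i \<in> B \<or> col i \<noteq> col j))"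

text \<open>Without edges every vertex is a class of its own; each edge added then costs at most one
  class outside \<open>B\<close>.\<close>

lemma labelling_exists:
  assumes "finite F" "simple_graph U F"
  shows "\<exists>\<rho> col B. labelling U F \<rho> col B \<and> card U \<le> card {r \<in> U. \<rho> r = r \<and> r \<notin> B} + card F"
  using assms
proof (induction F rule: finite_induct)
  case empty
  show ?case
    by (intro exI[of _ "\<lambda>i. i"] exI[of _ "\<lambda>_. True"] exI[of _ "{}"]) (simp add: labelling_def)
next
  case (insert e F)
  have G: "simple_graph U F" and U: "finite U" using insert.prems by (auto simp: simple_graph_def)
  obtain \<rho> col B where L: "labelling U F \<rho> col B"
    and c: "card U \<le> card {r \<in> U. \<rho> r = r \<and> r \<notin> B} + card F"
    using insert.IH[OF G] by blast
  obtain u w where e: "e = {u, w}" and uw: "u \<in> U" "w \<in> U" "u \<noteq> w"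
    using insert.prems by (auto simp: simple_graph_def card_2_iff)
  \<comment> \<open>\<open>x\<close> is the one representative lost to the new edge.\<close>
  have finish: ?case if L': "labelling U (insert e F) \<rho>' col' B'"
    and sub: "{r \<in> U. \<rho> r = r \<and> r \<notin> B} \<subseteq> insert x {r \<in> U. \<rho>' r = r \<and> r \<notin> B'}" for \<rho>' col' B' x
  proof -
    have "card {r \<in> U. \<rho> r = r \<and> r \<notin> B} \<le> card (insert x {r \<in> U. \<rho>' r = r \<and> r \<notin> B'})"
      using U by (intro card_mono sub) auto
    also have "\<dots> \<le> Suc (card {r \<in> U. \<rho>' r = r \<and> r \<notin> B'})"
      by (rule card_insert_le_m1) auto
    finally have "card U \<le> card {r \<in> U. \<rho>' r = r \<and> r \<notin> B'} + card (insert e F)"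
      using c insert.hyps by simp
    then show ?thesis using L' by blast
  qed
  have U\<rho>: "\<rho> i \<in> U" "\<rho> (\<rho> i) = \<rho> i" "col (\<rho> i)" if "i \<in> U" for i
    using L that by (auto simp: labelling_def)
  have F: "\<rho> i = \<rho> j" "\<rho> i \<in> B \<or> col i \<noteq> col j" if "{i, j} \<in> F" for i j
    using L that unfolding labelling_def by blast+
  have inF: "{i, j} \<in> insert e F \<longleftrightarrow> (i = u \<and> j = w) \<or> (i = w \<and> j = u) \<or> {i, j} \<in> F" for i j
    unfolding e by (auto simp: doubleton_eq_iff)
  show ?case
  proof (cases "\<rho> u = \<rho> w")
    case True
    \<comment> \<open>The class is put into \<open>B\<close> whatever the colours of
      \<open>u\<close> and \<open>w\<close>; the new edge pays for this loss.\<close>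
    have "labelling U (insert e F) \<rho> col (insert (\<rho> u) B)"
      unfolding labelling_def inF using U\<rho> F True by auto
    then show ?thesis by (rule finish[where x = "\<rho> u"]) auto
  next
    case False
    \<comment> \<open>The class of \<open>w\<close> is absorbed by that of \<open>u\<close>, its
      colours flipped if \<open>u\<close> and \<open>w\<close> agree. The representative
      \<open>\<rho> u\<close> is not recoloured and keeps the colour \<open>True\<close>.\<close>
    define \<rho>' where "\<rho>' i = (if \<rho> i = \<rho> w then \<rho> u else \<rho> i)" for i
    define col' where "col' i = (if \<rho> i = \<rho> w \<and> col u = col w then \<not> col i else col i)" for i
    define B' where "B' = (if \<rho> w \<in> B then insert (\<rho> u) B else B)"
    have L': "labelling U (insert e F) \<rho>' col' B'"
      unfolding labelling_def
    proof (intro conjI ballI allI impI)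
      fix i assume i: "i \<in> U"
      show "\<rho>' i \<in> U" "\<rho>' (\<rho>' i) = \<rho>' i" "col' (\<rho>' i)"
        using U\<rho>[OF i] U\<rho>[OF uw(1)] U\<rho>[OF uw(2)] False by (auto simp: \<rho>'_def col'_def)
    next
      fix i j assume "{i, j} \<in> insert e F"
      then consider "i = u" "j = w" | "i = w" "j = u" | "{i, j} \<in> F" unfolding inF by blast
      then have "\<rho>' i = \<rho>' j \<and> (\<rho>' i \<in> B' \<or> col' i \<noteq> col' j)"
      proof cases
        case 3
        then show ?thesis using F[OF 3] by (auto simp: \<rho>'_def col'_def B'_def)
      qed (use False in \<open>auto simp: \<rho>'_def col'_def B'_def\<close>)
      then show "\<rho>' i = \<rho>' j" "\<rho>' i \<in> B' \<or> col' i \<noteq> col' j" by blast+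
    qed
    \<comment> \<open>If the class of \<open>w\<close> is in \<open>B\<close>, so is the merged
      class, and \<open>\<rho> u\<close> is lost; otherwise \<open>\<rho> w\<close> merely stops
      being a representative.\<close>
    have "{r \<in> U. \<rho> r = r \<and> r \<notin> B} \<subseteq>
        insert (if \<rho> w \<in> B then \<rho> u else \<rho> w) {r \<in> U. \<rho>' r = r \<and> r \<notin> B'}"
      using False by (auto simp: \<rho>'_def B'_def)
    from finish[OF L' this] show ?thesis .
  qed
qed

text \<open>The action of the substitution \<open>y\<^sub>r \<mapsto> x\<^sub>r y\<^sub>r\<close>, \<open>r \<in> R\<close>, on exponents of monomials.\<close>

definition shift_exponent :: "nat set \<Rightarrow> (xy \<Rightarrow>\<^sub>0 nat) \<Rightarrow> (xy \<Rightarrow>\<^sub>0 nat)" where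
  "shift_exponent R m = m + (\<Sum>r\<in>R. Poly_Mapping.single (X r) (Poly_Mapping.lookup m (Y r)))"

lemma shift_exponent_hom: "shift_exponent R 0 = 0"
  "shift_exponent R (m + m') = shift_exponent R m + shift_exponent R m'"
  by (simp_all add: shift_exponent_def lookup_add single_add sum.distrib ac_simps)

lemma lookup_shift_exponent:
  assumes "finite R"
  shows "Poly_Mapping.lookup (shift_exponent R m) (Y i) = Poly_Mapping.lookup m (Y i)"
    "Poly_Mapping.lookup (shift_exponent R m) (X i) =
      Poly_Mapping.lookup m (X i) + (if i \<in> R then Poly_Mapping.lookup m (Y i) else 0)"
  using assms by (simp_all add: shift_exponent_def lookup_add lookup_sum lookup_single when_def)

lemma inj_shift_exponent:
  assumes "finite R"
  shows "inj (shift_exponent R)"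
proof (rule injI, rule poly_mapping_eqI)
  fix m m' v assume eq: "shift_exponent R m = shift_exponent R m'"
  have Y: "Poly_Mapping.lookup m (Y i) = Poly_Mapping.lookup m' (Y i)" for i
    using lookup_shift_exponent(1)[OF assms, of m i] lookup_shift_exponent(1)[OF assms, of m' i] eq by simp
  have "Poly_Mapping.lookup m (X i) = Poly_Mapping.lookup m' (X i)" for i
    using lookup_shift_exponent(2)[OF assms, of m i] lookup_shift_exponent(2)[OF assms, of m' i] eq Y[of i]
    by (cases "i \<in> R") simp_all
  with Y show "Poly_Mapping.lookup m v = Poly_Mapping.lookup m' v" by (cases v) auto
qed

text \<open>When variables go to monomials and the map on exponents is injective, no terms can
  cancel. This is how independence of a set of variables is verified below.\<close>

lemma subst_monomial_map:
  fixes f :: "('v, 'k::comm_ring_1) mpoly" and T :: "('v \<Rightarrow>\<^sub>0 nat) \<Rightarrow> ('w \<Rightarrow>\<^sub>0 nat)"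
  assumes T: "T 0 = 0" "\<And>m m'. T (m + m') = T m + T m'" "inj T"
    and s: "\<And>v. v \<in> W \<Longrightarrow> s v = [:Poly_Mapping.single (T (Poly_Mapping.single v 1)) 1:]"
    and f: "f \<in> mpolys W"
  obtains g where "subst s f = [:g:]" "g = 0 \<Longrightarrow> f = 0"
proof -
  have mon: "mon_subst s m = [:Poly_Mapping.single (T m) 1:]" if "Poly_Mapping.keys m \<subseteq> W" for m
    using that
  proof (induction m rule: exponent_induct)
    case zero
    then show ?case by (simp add: mon_subst_def T one_pCons)
  next
    case (add v m)
    have "mon_subst s (Poly_Mapping.single v 1) = s v" by (simp add: mon_subst_def)
    then show ?case using add s[OF add(1)]
      by (simp add: mon_subst_add T mult_single add.commute del: One_nat_def)
  qed
  define g where "g = (\<Sum>m\<in>Poly_Mapping.keys f. Poly_Mapping.single (T m) (Poly_Mapping.lookup f m))"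
  have "subst s f = (\<Sum>m\<in>Poly_Mapping.keys f. [:Poly_Mapping.single (T m) (Poly_Mapping.lookup f m):])"
    unfolding subst_def using f by (intro sum.cong refl) (simp add: mpolys_iff mon mult_single)
  also have "\<dots> = [:g:]"
  proof -
    have "(\<Sum>m\<in>A. [:h m:]) = [:\<Sum>m\<in>A. h m:]" if "finite A" for A and h :: "('v \<Rightarrow>\<^sub>0 nat) \<Rightarrow> ('w, 'k) mpoly"
      using that by (induction A rule: finite_induct) auto
    then show ?thesis by (simp add: g_def)
  qed
  finally have 1: "subst s f = [:g:]" .
  have 2: "f = 0" if "g = 0"
  proof (rule poly_mapping_eqI)
    fix m
    have "Poly_Mapping.lookup g (T m) = (\<Sum>m'\<in>Poly_Mapping.keys f. if m' = m then Poly_Mapping.lookup f m' else 0)"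
      unfolding g_def lookup_sum using T(3)
      by (intro sum.cong refl) (auto simp: lookup_single when_def dest: injD)
    also have "\<dots> = Poly_Mapping.lookup f m" by (simp add: in_keys_iff)
    finally show "Poly_Mapping.lookup f m = Poly_Mapping.lookup 0 m" using that by simp
  qed
  show ?thesis by (rule that[OF 1 2])
qed

text \<open>A parametrisation of part of the zero set of the edge ideal: \<open>(x\<^sub>i, y\<^sub>i)\<close> vanishes on \<open>Z\<close>, is
  \<open>s\<^sub>i (1, t)\<close> with \<open>1 + c t\<^sup>2 = 0\<close> on the classes in \<open>B\<close>, and \<open>s\<^sub>i (1, q)\<close> or \<open>s\<^sub>i (- c q, 1)\<close>,
  depending on the colour of \<open>i\<close>, on the other classes, where \<open>q\<close> depends on the class only.\<close>

lemma height_edge_ideal_le: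
  fixes c :: "'k::field"
  assumes G: "simple_graph {1..n} E" and Z: "Z \<subseteq> {1..n}" and c: "c \<noteq> 0"
  shows "height (poly_ring (xy_vars n)) (edge_ideal c n E) \<le> enat (2 * card Z + card {e \<in> E. e \<inter> Z = {}})"
proof -
  define U where "U = {1..n} - Z"
  define F where "F = {e \<in> E. e \<inter> Z = {}}"
  have GF: "simple_graph U F" using G by (auto simp: simple_graph_def U_def F_def)
  have "finite F"
    using GF by (intro finite_subset[of F "Pow U"]) (auto simp: simple_graph_def)
  then obtain \<rho> col B where L: "labelling U F \<rho> col B"
    and count: "card U \<le> card {r \<in> U. \<rho> r = r \<and> r \<notin> B} + card F"
    using labelling_exists[OF _ GF] by blast
  define R where "R = {r \<in> U. \<rho> r = r \<and> r \<notin> B}"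
  have finR: "finite R" by (simp add: R_def U_def)
  define s :: "xy \<Rightarrow> (xy, 'k) mpoly poly" where
    "s v = (case v of
        X i \<Rightarrow> if i \<notin> U then 0 else if \<rho> i \<in> B \<or> col i then [:var (X i):]
               else [:Const (- c) * (var (Y i) * var (Y (\<rho> i))):]
      | Y i \<Rightarrow> if i \<notin> U then 0 else if \<rho> i \<in> B then [:0, var (X i):]
               else if col i then [:var (X i) * var (Y (\<rho> i)):] else [:var (Y i):])" for v
  \<comment> \<open>The first part collects the variables whose images are the scalars s_i. For r in
    \<open>R\<close>, the target variable \<open>Y r\<close> serves as q: since \<open>col r\<close>
    holds it is not one of the scalars, and the image of \<open>Y r\<close> itself is s_r q.\<close>
  define W where "W = (\<lambda>i. if \<rho> i \<in> B \<or> col i then X i else Y i) ` U \<union> Y ` R"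
  define d where "d = [:1, 0, Const c :: (xy, 'k) mpoly:]"
  define J where "J = {f \<in> mpolys (xy_vars n). d dvd subst s f}"
  have J: "ideal_in (mpolys (xy_vars n)) J"
    by (auto simp: ideal_in_def J_def)
  have edges: "edge_polys c E \<subseteq> J"
  proof
    fix f assume f: "f \<in> edge_polys c E"
    then obtain i j where fij: "f = edge_poly c i j" and ij: "{i, j} \<in> E" by (auto simp: edge_polys_def)
    have e: "subst s f = s (X i) * s (X j) + [:Const c:] * (s (Y i) * s (Y j))"
      by (simp add: fij edge_poly_def del: mult_pCons_left)
    have "d dvd subst s f"
    proof (cases "i \<in> U \<and> j \<in> U")
      case False
      then show ?thesis unfolding e by (auto simp: s_def)
    next
      case True
      then have "{i, j} \<in> F" using ij by (auto simp: F_def U_def)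
      then have \<rho>: "\<rho> j = \<rho> i" "\<rho> i \<in> B \<or> col i \<noteq> col j"
        using L unfolding labelling_def by metis+
      show ?thesis
      proof (cases "\<rho> i \<in> B")
        case bad: True
        have "subst s f = d * [:var (X i) * var (X j):]"
          unfolding e using True bad \<rho>(1) by (simp add: s_def d_def mult_ac)
        then show ?thesis unfolding dvd_def by blast
      next
        case False
        have neg: "Const (- c) = - (Const c :: (xy, 'k) mpoly)" by (simp add: single_uminus)
        have "subst s f = 0"
          unfolding e using True False \<rho> by (cases "col i") (simp_all add: s_def neg mult_ac)
        then show ?thesis by simp
      qed
    qed
    then show "f \<in> J" using f edge_polys_subset[OF G, of c] by (auto simp: J_def)
  qed
  have IJ: "edge_ideal c n E \<subseteq> J"
    unfolding edge_ideal_def by (rule genideal_ideal_in(3)[OF edge_polys_subset[OF G] J edges])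
  have R: "r \<in> U" "\<rho> r = r" "r \<notin> B" "col r" if "r \<in> R" for r
    using that L by (auto simp: R_def labelling_def)
  have "indep_mod J W"
    unfolding indep_mod_def
  proof
    fix f assume f: "f \<in> J \<inter> mpolys W"
    have s_W: "s v = [:Poly_Mapping.single (shift_exponent R (Poly_Mapping.single v 1)) 1:]" if "v \<in> W" for v
    proof (cases v)
      case (X i)
      have "shift_exponent R (Poly_Mapping.single v 1) = Poly_Mapping.single v 1"
        by (simp add: shift_exponent_def X lookup_single)
      moreover have "s v = [:var v:]"
        using that X by (auto simp: W_def s_def split: if_splits)
      ultimately show ?thesis by (simp add: var_def)
    next
      case (Y i)
      have T: "shift_exponent R (Poly_Mapping.single v 1) =
          Poly_Mapping.single v 1 + (if i \<in> R then Poly_Mapping.single (X i) 1 else 0)"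
      proof -
        have "(\<Sum>r\<in>R. Poly_Mapping.single (X r) (Poly_Mapping.lookup (Poly_Mapping.single v 1) (Y r))) =
          (\<Sum>r\<in>R. if r = i then Poly_Mapping.single (X r) (1::nat) else 0)"
          by (intro sum.cong refl) (simp add: Y lookup_single when_def)
        then show ?thesis using finR by (simp add: shift_exponent_def)
      qed
      show ?thesis
      proof (cases "i \<in> R")
        case True
        then show ?thesis using R[OF True] T Y
          by (simp add: s_def var_mult_var add.commute)
      next
        case False
        then have "i \<in> U" "\<rho> i \<notin> B" "\<not> col i" using that Y by (auto simp: W_def split: if_splits)
        then show ?thesis using T Y False by (simp add: s_def var_def)
      qed
    qed
    obtain g where g: "subst s f = [:g:]" "g = 0 \<Longrightarrow> f = 0"
      using subst_monomial_map[OF shift_exponent_hom inj_shift_exponent[OF finR] s_W, of W f] f by blast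
    \<comment> \<open>The image of \<open>f\<close> is constant in t, whereas \<open>d\<close> has
      degree 2 because c is nonzero.\<close>
    have "g = 0"
    proof (rule ccontr)
      assume "g \<noteq> 0"
      moreover have "d dvd [:g:]" using f g by (simp add: J_def)
      ultimately have "degree d \<le> degree [:g:]" by (intro dvd_imp_degree_le) auto
      moreover have "Const c \<noteq> (0 :: (xy, 'k) mpoly)" using c by (metis lookup_single_eq lookup_zero)
      ultimately show False by (simp add: d_def)
    qed
    then show "f \<in> {0}" using g by simp
  qed
  moreover have "W \<subseteq> xy_vars n" by (auto simp: W_def xy_vars_def U_def R_def)
  moreover have "card W = card U + card R"
  proof -
    have "card W = card ((\<lambda>i. if \<rho> i \<in> B \<or> col i then X i else Y i) ` U) + card (Y ` R)"
      unfolding W_def using R finR by (intro card_Un_disjoint) (auto simp: U_def split: if_splits)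
    also have "card ((\<lambda>i. if \<rho> i \<in> B \<or> col i then X i else Y i) ` U) = card U"
      by (intro card_image inj_onI) (auto split: if_splits)
    also have "card (Y ` R) = card R" by (intro card_image inj_onI) auto
    finally show ?thesis .
  qed
  ultimately have le: "height (poly_ring (xy_vars n)) J \<le> enat (2 * n - (card U + card R))"
    using height_le[OF card_xy_vars(1) _ J, of W] by (simp add: card_xy_vars)
  have "height (poly_ring (xy_vars n)) (edge_ideal c n E) \<le> height (poly_ring (xy_vars n)) J"
    unfolding height_def using IJ by (intro Inf_superset_mono) auto
  also note le
  \<comment> \<open>Since |U| + |Z| = n, the left side is 2|Z| + |U| - |R|, and \<open>count\<close>
    bounds |U| - |R| by |F|.\<close>
  also have "2 * n - (card U + card R) \<le> 2 * card Z + card F"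
  proof -
    have "card U + card Z = n"
      unfolding U_def using Z card_mono[OF _ Z] by (simp add: card_Diff_subset finite_subset)
    then show ?thesis using count unfolding R_def by linarith
  qed
  finally show ?thesis by (simp add: F_def)
qed

section \<open>Odd cycles\<close>

text \<open>Plane geometry for the form x x' + c y y' over the domain S/P: each step through a
  nonzero vector turns orthogonality into parallelism or back, so the parity of k decides. The two
  end vectors may vanish.\<close>

lemma alternating_relation:
  fixes x y :: "nat \<Rightarrow> 'r::comm_ring_1"
  assumes S: "is_subring S" and P: "prime_in S P"
    and xy: "\<And>i. x i \<in> S" "\<And>i. y i \<in> S" and c: "c \<in> S" "c' \<in> S" "c' * c = 1"
    and rel: "\<And>i. x i * x (Suc i) + c * (y i * y (Suc i)) \<in> P"
    and "k > 0" and "\<And>l. 0 < l \<Longrightarrow> l < k \<Longrightarrow> \<not> (x (i + l) \<in> P \<and> y (i + l) \<in> P)"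
  shows "if odd k then x i * x (i + k) + c * (y i * y (i + k)) \<in> P else x i * y (i + k) - y i * x (i + k) \<in> P"
  using assms(9,10)
proof (induction k rule: nat_induct_non_zero)
  case 1
  then show ?case using rel[of i] by simp
next
  case (Suc k)
  note Pi = prime_inD(1)[OF P]
  let ?b = "i + k" and ?d = "i + Suc k"
  have IH: "if odd k then x i * x ?b + c * (y i * y ?b) \<in> P else x i * y ?b - y i * x ?b \<in> P"
    using Suc by auto
  have r: "x ?b * x ?d + c * (y ?b * y ?d) \<in> P" using rel[of ?b] by simp
  \<comment> \<open>One coordinate of the vector at \<open>?b\<close> is outside \<open>P\<close>,
    so it suffices to treat the products of \<open>t\<close> with both coordinates.\<close>
  have cancel: "t \<in> P" if "t \<in> S" "x ?b * t \<in> P" "y ?b * t \<in> P" for t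
    using that prime_inD(3)[OF P xy(1)[of ?b] that(1)] prime_inD(3)[OF P xy(2)[of ?b] that(1)]
      Suc.prems[of k] Suc.hyps by auto
  note mem = is_subringD(4,5,6)[OF S] xy c
  note idl = ideal_in_diff[OF Pi S] ideal_inD(3)[OF Pi]
  show ?case
  proof (cases "odd k")
    case True
    let ?u = "x i * x ?b + c * (y i * y ?b)" and ?v = "x ?b * x ?d + c * (y ?b * y ?d)"
    let ?t = "x i * y ?d - y i * x ?d"
    have u: "?u \<in> P" using IH True by simp
    have "x ?b * ?t = ?u * y ?d - ?v * y i" by (simp add: algebra_simps)
    also have "\<dots> \<in> P" by (intro idl(1) ideal_inD(5)[OF Pi] u r xy)
    finally have 1: "x ?b * ?t \<in> P" .
    \<comment> \<open>The combination of \<open>?u\<close> and \<open>?v\<close> yields only c times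
      this product; \<open>c'\<close> removes the factor.\<close>
    have "y ?b * ?t = (c' * c) * (y ?b * ?t)" using c(3) by simp
    also have "\<dots> = c' * (?v * x i - ?u * x ?d)" by (simp add: algebra_simps)
    also have "\<dots> \<in> P" by (intro ideal_inD(4)[OF Pi c(2)] idl(1) ideal_inD(5)[OF Pi] u r xy)
    finally have 2: "y ?b * ?t \<in> P" .
    show ?thesis using cancel[OF _ 1 2] True by (simp add: mem)
  next
    case False
    let ?u = "x i * y ?b - y i * x ?b" and ?v = "x ?b * x ?d + c * (y ?b * y ?d)"
    let ?t = "x i * x ?d + c * (y i * y ?d)"
    have u: "?u \<in> P" using IH False by simp
    have "x ?b * ?t = ?v * x i - ?u * (c * y ?d)" by (simp add: algebra_simps)
    also have "\<dots> \<in> P" by (intro idl(1) ideal_inD(5)[OF Pi] u r xy mem)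
    finally have 1: "x ?b * ?t \<in> P" .
    have "y ?b * ?t = ?u * x ?d + ?v * y i" by (simp add: algebra_simps)
    also have "\<dots> \<in> P" by (intro idl(2) ideal_inD(5)[OF Pi] u r xy)
    finally have 2: "y ?b * ?t \<in> P" .
    show ?thesis using cancel[OF _ 1 2] False by (simp add: mem)
  qed
qed

lemma xy_minor_nonzero:
  assumes "a \<noteq> b"
  shows "var (X a) * var (Y b) - var (Y a) * var (X b) \<noteq> (0 :: (xy, 'k::field) mpoly)"
proof
  assume "var (X a) * var (Y b) - var (Y a) * var (X b) = (0 :: (xy, 'k) mpoly)"
  moreover have "Poly_Mapping.single (Y a) 1 + Poly_Mapping.single (X b) 1 \<noteq>
      Poly_Mapping.single (X a) (1::nat) + Poly_Mapping.single (Y b) 1"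
    using assms by (subst single_plus_single_eq_iff) (auto simp: doubleton_eq_iff)
  ultimately have "(1 :: 'k) = 0"
    unfolding var_mult_var by (metis diff_eq_eq add_0 lookup_single_eq lookup_single_not_eq)
  then show False by simp
qed

text \<open>The indices may coincide, as they do after a walk once around the cycle.\<close>

lemma edge_poly_nonzero: "edge_poly c i j \<noteq> 0"
proof
  let ?m = "Poly_Mapping.single (X i) (1::nat) + Poly_Mapping.single (X j) 1"
  assume "edge_poly c i j = 0"
  then have "Poly_Mapping.lookup (edge_poly c i j) ?m = 0" by simp
  moreover have "Poly_Mapping.single (Y i) (1::nat) + Poly_Mapping.single (Y j) 1 \<noteq> ?m"
  proof
    assume "Poly_Mapping.single (Y i) (1::nat) + Poly_Mapping.single (Y j) 1 = ?m"
    then have "Poly_Mapping.lookup (Poly_Mapping.single (Y i) (1::nat) + Poly_Mapping.single (Y j) 1) (X i) =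
      Poly_Mapping.lookup ?m (X i)" by simp
    then show False by (simp add: lookup_add lookup_single when_def split: if_splits)
  qed
  ultimately show False by (simp add: edge_poly_eq lookup_add lookup_single when_def)
qed

lemma var_nonzero: "var v \<noteq> (0 :: ('v, 'k::comm_ring_1) mpoly)"
  by (metis var_def lookup_single_eq lookup_zero zero_neq_one)

lemma odd_cycle_indep_bound:
  fixes c :: "'k::field" and P :: "(xy, 'k) mpoly set"
  assumes G: "simple_graph {1..n} E" and C: "odd_cycle {1..n} E" and c: "c \<noteq> 0"
    and P: "prime_in (mpolys (xy_vars n)) P" and IP: "edge_ideal c n E \<subseteq> P"
    and W: "W \<subseteq> xy_vars n" "indep_mod P W"
  shows "card W \<le> n"
proof -
  obtain cc where n: "odd n" "3 \<le> n" and cc: "bij_betw cc {..<n} {1..n}"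
    and E: "E = {{cc i, cc (Suc i mod n)} | i. i < n}"
    using C by (auto simp: odd_cycle_def cycle_graph_def)
  \<comment> \<open>The enumeration is continued periodically, so that walks can run past its
    end.\<close>
  define v where "v i = cc (i mod n)" for i
  define x y :: "nat \<Rightarrow> (xy, 'k) mpoly" where "x i = var (X (v i))" and "y i = var (Y (v i))" for i
  have v_mem: "v i \<in> {1..n}" for i
    using bij_betwE[OF cc] n unfolding v_def by auto
  have v_eq: "v i = v j \<longleftrightarrow> i mod n = j mod n" for i j
    using bij_betw_imp_inj_on[OF cc] n unfolding v_def by (auto simp: inj_on_eq_iff)
  have v_surj: "\<exists>i<n. v i = a" if "a \<in> {1..n}" for a
  proof -
    have "a \<in> cc ` {..<n}" using that bij_betw_imp_surj_on[OF cc] by simp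
    then obtain i where "i < n" "cc i = a" by auto
    then show ?thesis by (intro exI[of _ i]) (simp add: v_def)
  qed
  have edge: "{v i, v (Suc i)} \<in> E" for i
    using n unfolding E v_def by (intro CollectI exI[of _ "i mod n"]) (simp add: mod_Suc_eq)
  have xyS: "x i \<in> mpolys (xy_vars n)" "y i \<in> mpolys (xy_vars n)" for i
    using v_mem[of i] unfolding x_def y_def by (intro var_in_mpolys; simp add: xy_vars_def)+
  have rel: "x i * x (Suc i) + Const c * (y i * y (Suc i)) \<in> P" for i
  proof -
    have "edge_poly c (v i) (v (Suc i)) \<in> edge_polys c E" using edge[of i] by (auto simp: edge_polys_def)
    then show ?thesis
      using IP genideal_ideal_in(2)[OF edge_polys_subset[OF G]]
      unfolding edge_ideal_def x_def y_def edge_poly_def by blast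
  qed
  have inverse: "Const (1 / c) * Const c = (1 :: (xy, 'k) mpoly)" using c by (simp add: mult_single)
  define zero where "zero i \<longleftrightarrow> x i \<in> P \<and> y i \<in> P" for i
  define D where "D = {i. i < n \<and> X (v i) \<in> W \<and> Y (v i) \<in> W}"
  define Z where "Z = {i. i < n \<and> zero i}"
  \<comment> \<open>The case k = n, a walk back to its start, is included; as n is odd, it yields an
    orthogonality relation.\<close>
  have between: "\<exists>l. 0 < l \<and> l < k \<and> zero (i + l)"
    if i: "i \<in> D" "0 < k" "k \<le> n" "(i + k) mod n \<in> D" for i k
  proof (rule ccontr)
    assume neg: "\<not> ?thesis"
    have vk: "v (i + k) = v ((i + k) mod n)" by (simp add: v_eq)
    have mem: "x i \<in> mpolys W" "y i \<in> mpolys W" "x (i + k) \<in> mpolys W" "y (i + k) \<in> mpolys W"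
      using i unfolding x_def y_def vk by (auto simp: D_def)
    have "if odd k then x i * x (i + k) + Const c * (y i * y (i + k)) \<in> P else x i * y (i + k) - y i * x (i + k) \<in> P"
      by (rule alternating_relation[where x = x and y = y and i = i and k = k,
            OF is_subring_mpolys P xyS _ _ inverse rel i(2)])
        (use neg in \<open>auto simp: zero_def\<close>)
    moreover have "x i * x (i + k) + Const c * (y i * y (i + k)) \<notin> P"
    proof
      assume "x i * x (i + k) + Const c * (y i * y (i + k)) \<in> P"
      then have "x i * x (i + k) + Const c * (y i * y (i + k)) = 0"
        using W(2) mem unfolding indep_mod_def by (auto simp: subset_iff)
      then show False using edge_poly_nonzero[of c "v i" "v (i + k)"] by (simp add: edge_poly_def x_def y_def)
    qed
    moreover have "x i * y (i + k) - y i * x (i + k) \<notin> P" if "even k"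
    proof
      assume "x i * y (i + k) - y i * x (i + k) \<in> P"
      then have "x i * y (i + k) - y i * x (i + k) = 0"
        using W(2) mem unfolding indep_mod_def by (auto simp: subset_iff)
      \<comment> \<open>An even k cannot be the odd number n, so the walk ends at another vertex and
        the minor is a nonzero polynomial.\<close>
      moreover have "v i \<noteq> v (i + k)"
      proof
        assume "v i = v (i + k)"
        then have "n dvd k" by (simp add: v_eq) (metis add_diff_cancel_left' mod_eq_dvd_iff_nat le_add1)
        then have "k = n" using i(2,3) by (auto dest: dvd_imp_le)
        then show False using n(1) \<open>even k\<close> by simp
      qed
      ultimately show False using xy_minor_nonzero[where 'k = 'k, OF \<open>v i \<noteq> v (i + k)\<close>] by (simp add: x_def y_def)
    qed
    ultimately show False by (cases "odd k") auto
  qed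
  define next_zero where "next_zero i = (LEAST k. 0 < k \<and> zero (i + k))" for i
  have next_zero: "0 < next_zero i" "zero (i + next_zero i)" "next_zero i < k"
    if i: "i \<in> D" "0 < k" "k \<le> n" "(i + k) mod n \<in> D" for i k
  proof -
    obtain l where l: "0 < l" "l < k" "zero (i + l)" using between[OF i] by blast
    have "0 < next_zero i \<and> zero (i + next_zero i)"
      unfolding next_zero_def by (rule LeastI[of _ l]) (use l in auto)
    then show "0 < next_zero i" "zero (i + next_zero i)" by auto
    have "next_zero i \<le> l" unfolding next_zero_def by (rule Least_le) (use l in auto)
    then show "next_zero i < k" using l by simp
  qed
  \<comment> \<open>The full turn provides a next zero even for the only member of
    \<open>D\<close>.\<close>
  have self: "i \<in> D" "0 < n" "n \<le> n" "(i + n) mod n \<in> D" if "i \<in> D" for i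
    using that n by (auto simp: D_def)
  have zero_mod: "zero (i mod n) = zero i" for i by (simp add: zero_def x_def y_def v_def)
  \<comment> \<open>The next zero after i comes before j, and the one after j before i + n, so these
    positions differ by a positive number less than n.\<close>
  have inj: "inj_on (\<lambda>i. (i + next_zero i) mod n) D"
  proof (rule linorder_inj_onI)
    fix i j assume ij: "i < j" "i \<in> D" "j \<in> D"
    have "j < n" using ij by (simp add: D_def)
    have 1: "next_zero i < j - i"
      using ij \<open>j < n\<close> by (intro next_zero(3)) auto
    have 2: "next_zero j < n - (j - i)"
      using ij \<open>j < n\<close> by (intro next_zero(3)) auto
    have pos: "0 < next_zero j" using next_zero(1)[OF self[OF ij(3)]] .
    show "(i + next_zero i) mod n \<noteq> (j + next_zero j) mod n"
    proof
      assume eq: "(i + next_zero i) mod n = (j + next_zero j) mod n"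
      have "n dvd (j + next_zero j) - (i + next_zero i)"
        using eq 1 by (subst mod_eq_dvd_iff_nat[symmetric]) auto
      moreover have "0 < (j + next_zero j) - (i + next_zero i)" "(j + next_zero j) - (i + next_zero i) < n"
        using 1 2 pos ij \<open>j < n\<close> by auto
      ultimately show False by (auto dest: dvd_imp_le)
    qed
  qed (auto simp: D_def)
  have "(\<lambda>i. (i + next_zero i) mod n) ` D \<subseteq> Z"
    using next_zero(2)[OF self] n by (auto simp: Z_def zero_mod)
  then have DZ: "card D \<le> card Z"
    using card_inj_on_le[OF inj] by (simp add: Z_def)
  \<comment> \<open>Vertices with both variables in \<open>W\<close> are counted twice in |A| + |B|.
    The excess is |D|, and the zero vertices pay for it: they have no variable in \<open>W\<close>,
    since variables of \<open>W\<close> are outside \<open>P\<close>.\<close>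
  define A B where "A = {i. i < n \<and> X (v i) \<in> W}" and "B = {i. i < n \<and> Y (v i) \<in> W}"
  have notin: "var w \<notin> P" if "w \<in> W" for w
    using W(2) that var_nonzero[of w] unfolding indep_mod_def by auto
  have "(A \<union> B) \<inter> Z = {}"
    using notin by (auto simp: A_def B_def Z_def zero_def x_def y_def)
  moreover have "finite (A \<union> B)" "finite Z" by (auto simp: A_def B_def Z_def)
  ultimately have "card (A \<union> B) + card Z = card (A \<union> B \<union> Z)"
    by (simp add: card_Un_disjoint)
  also have "\<dots> \<le> card {..<n}" by (intro card_mono) (auto simp: A_def B_def Z_def)
  finally have "card (A \<union> B) + card Z \<le> n" by simp
  moreover have "card A + card B = card (A \<union> B) + card (A \<inter> B)"
    by (rule card_Un_Int) (auto simp: A_def B_def)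
  moreover have "A \<inter> B = D" by (auto simp: A_def B_def D_def)
  moreover have "card W \<le> card A + card B"
  proof -
    have "W \<subseteq> (\<lambda>i. X (v i)) ` A \<union> (\<lambda>i. Y (v i)) ` B"
    proof
      fix w assume w: "w \<in> W"
      then consider a where "w = X a" "a \<in> {1..n}" | a where "w = Y a" "a \<in> {1..n}"
        using W(1) by (auto simp: xy_vars_def)
      then show "w \<in> (\<lambda>i. X (v i)) ` A \<union> (\<lambda>i. Y (v i)) ` B"
        using v_surj w by cases (force simp: A_def B_def)+
    qed
    then have "card W \<le> card ((\<lambda>i. X (v i)) ` A \<union> (\<lambda>i. Y (v i)) ` B)"
      by (intro card_mono) (auto simp: A_def B_def)
    also have "\<dots> \<le> card ((\<lambda>i. X (v i)) ` A) + card ((\<lambda>i. Y (v i)) ` B)" by (rule card_Un_le)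
    also have "\<dots> \<le> card A + card B" by (intro add_mono card_image_le) (auto simp: A_def B_def)
    finally show ?thesis .
  qed
  ultimately show ?thesis using DZ by simp
qed

section \<open>Graphs of maximum degree at most two\<close>

lemma odd_cycle_if_max_degree_2:
  assumes G: "simple_graph V E" and conn: "connected_graph V E" and nb: "\<not> bipartite_graph V E"
    and deg: "\<And>v. v \<in> V \<Longrightarrow> card {e \<in> E. v \<in> e} \<le> 2"
  shows "odd_cycle V E"
proof -
  have V: "finite V" "V \<noteq> {}" using G conn by (auto simp: simple_graph_def connected_graph_def)
  note edgeD = simple_graph_edge[OF G]
  have finE: "finite E"
    using G by (intro finite_subset[of E "Pow V"]) (auto simp: simple_graph_def)
  have deg3: "a = b \<or> a = d \<or> b = d" if e: "{u, a} \<in> E" "{u, b} \<in> E" "{u, d} \<in> E" for u a b d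
  proof (rule ccontr)
    assume neg: "\<not> ?thesis"
    have "card {{u, a}, {u, b}, {u, d}} \<le> card {e \<in> E. u \<in> e}"
      using e finE by (intro card_mono) auto
    also have "\<dots> \<le> 2" by (rule deg[OF edgeD(1)[OF e(1)]])
    finally show False using neg by (auto simp: card_insert_if doubleton_eq_iff split: if_splits)
  qed
  \<comment> \<open>A longest path is chosen: once no edge leaves it, connectedness makes it pass
    through all vertices.\<close>
  define path where "path p \<longleftrightarrow> p \<noteq> [] \<and> distinct p \<and> set p \<subseteq> V \<and> (\<forall>i. Suc i < length p \<longrightarrow> {p ! i, p ! Suc i} \<in> E)" for p
  have bound: "length p < Suc (card V)" if "path p" for p
    using that V(1) card_mono[of V "set p"] distinct_card[of p] by (auto simp: path_def)
  obtain v0 where "v0 \<in> V" using V by blast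
  then have "path [v0]" by (simp add: path_def)
  then obtain p where p: "path p" and p_max: "\<And>q. path q \<Longrightarrow> length q \<le> length p"
    using ex_has_greatest_nat[of path "[v0]" length "Suc (card V)"] bound by blast
  define k where "k = length p"
  have k: "k > 0" and dist: "distinct p" and pV: "set p \<subseteq> V"
    and pE: "\<And>i. Suc i < k \<Longrightarrow> {p ! i, p ! Suc i} \<in> E"
    using p by (auto simp: path_def k_def)
  have nth_eq: "p ! i = p ! j \<longleftrightarrow> i = j" if "i < k" "j < k" for i j
    using nth_eq_iff_index_eq[OF dist] that by (simp add: k_def)
  have pE': "{p ! i, p ! (i - 1)} \<in> E" if "0 < i" "i < k" for i
    using pE[of "i - 1"] that by (simp add: insert_commute)
  \<comment> \<open>At an end of the path such an edge would prolong it, and an inner vertex already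
    has two neighbours on it.\<close>
  have closed: "w \<in> set p" if i: "i < k" and w: "{p ! i, w} \<in> E" for i w
  proof (rule ccontr)
    assume nw: "w \<notin> set p"
    have wV: "w \<in> V" using edgeD(2)[OF w] .
    consider "i = 0" | "i = k - 1" | "0 < i" "Suc i < k" using i by linarith
    then show False
    proof cases
      case 1
      have "path (w # p)"
        using p nw wV w 1 by (auto simp: path_def nth_Cons insert_commute hd_conv_nth split: nat.split)
      then show False using p_max[of "w # p"] by simp
    next
      case 2
      have "path (p @ [w])"
        unfolding path_def
      proof (intro conjI allI impI)
        fix j assume j: "Suc j < length (p @ [w])"
        show "{(p @ [w]) ! j, (p @ [w]) ! Suc j} \<in> E"
        proof (cases "Suc j < k")
          case True
          then show ?thesis using pE[of j] by (simp add: nth_append k_def)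
        next
          case False
          then have "j = k - 1" using j by (simp add: k_def)
          then show ?thesis using w 2 k by (simp add: nth_append k_def)
        qed
      qed (use p nw wV in \<open>auto simp: path_def\<close>)
      then show False using p_max[of "p @ [w]"] by simp
    next
      case 3
      have "p ! (i - 1) \<noteq> p ! Suc i" using 3 by (simp add: nth_eq)
      then have "w = p ! (i - 1) \<or> w = p ! Suc i"
        using deg3[OF pE'[OF 3(1) i] pE[OF 3(2)] w] by auto
      then show False using nw 3 by (auto simp: k_def)
    qed
  qed
  have setp: "set p = V"
  proof
    show "V \<subseteq> set p"
    proof
      fix u assume u: "u \<in> V"
      have "p ! 0 \<in> V" using pV k by (auto simp: k_def)
      then have "(p ! 0, u) \<in> {(a, b). {a, b} \<in> E}\<^sup>*" using conn u by (auto simp: connected_graph_def)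
      then show "u \<in> set p"
      proof (induction rule: rtrancl_induct)
        case base
        then show ?case using k by (simp add: k_def)
      next
        case (step a b)
        then obtain i where "i < k" "p ! i = a" by (auto simp: in_set_conv_nth k_def)
        then show ?case using closed step by auto
      qed
    qed
  qed (rule pV)
  have card_V: "card V = k" using distinct_card[OF dist] by (simp add: setp k_def)
  \<comment> \<open>An inner vertex has its two path neighbours only, so an additional edge must
    join the two ends.\<close>
  have edges: "j = Suc i \<or> (i = 0 \<and> j = k - 1)" if e: "{p ! i, p ! j} \<in> E" and ij: "i < j" "j < k" for i j
  proof (rule ccontr)
    assume neg: "\<not> ?thesis"
    then have j: "Suc i < j" using ij by linarith
    have i: "i = 0"
    proof (rule ccontr)
      assume "i \<noteq> 0"
      then show False
        using deg3[OF pE'[of i] pE[of i] e] ij j by (auto simp: nth_eq)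
    qed
    then have "Suc j < k" using neg ij by linarith
    moreover have "{p ! j, p ! i} \<in> E" using e by (simp add: insert_commute)
    ultimately show False
      using deg3[OF pE'[of j] pE[of j] \<open>{p ! j, p ! i} \<in> E\<close>] ij j i by (auto simp: nth_eq)
  qed
  have edge_form: "\<exists>i j. e = {p ! i, p ! j} \<and> i < j \<and> j < k" if e: "e \<in> E" for e
  proof -
    obtain a b where ab: "e = {a, b}" "a \<noteq> b" "a \<in> V" "b \<in> V"
      using G e by (auto simp: simple_graph_def card_2_iff)
    then obtain i j where "i < k" "j < k" "a = p ! i" "b = p ! j"
      using setp by (metis in_set_conv_nth k_def)
    then show ?thesis using ab by (metis insert_commute linorder_neqE_nat)
  qed
  \<comment> \<open>Otherwise the parity of positions is a proper 2-colouring, since only an edge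
    joining the ends of a path with an odd number of vertices could spoil it.\<close>
  have cyc: "odd k \<and> 3 \<le> k \<and> {p ! 0, p ! (k - 1)} \<in> E"
  proof (rule ccontr)
    assume neg: "\<not> ?thesis"
    have "bipartite_graph V E"
      unfolding bipartite_graph_def
    proof (intro exI conjI ballI)
      let ?A = "{p ! i |i. i < k \<and> even i}" and ?B = "{p ! i |i. i < k \<and> odd i}"
      show "?A \<union> ?B = V" unfolding setp[symmetric] set_conv_nth k_def by blast
      show "?A \<inter> ?B = {}" using nth_eq by auto
      fix e assume e: "e \<in> E"
      then obtain i j where ij: "e = {p ! i, p ! j}" "i < j" "j < k" using edge_form by blast
      have "even i \<longleftrightarrow> odd j"
      proof (cases "j = Suc i")
        case False
        then have "i = 0" "j = k - 1" using edges[of i j] ij e by auto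
        moreover from this have "3 \<le> k" using False ij by auto
        ultimately show ?thesis using neg e ij by auto
      qed simp
      then have "p ! i \<in> ?A \<and> p ! j \<in> ?B \<or> p ! i \<in> ?B \<and> p ! j \<in> ?A"
        using ij(2,3) by (cases "even i") auto
      moreover have "e = {p ! j, p ! i}" using ij(1) by (simp add: insert_commute)
      ultimately show "\<exists>a\<in>?A. \<exists>b\<in>?B. e = {a, b}" using ij(1) by (elim disjE conjE) (rule bexI bexI | assumption)+
    qed
    then show False using nb by blast
  qed
  have "E = {{p ! i, p ! (Suc i mod k)} |i. i < k}"
  proof (rule equalityI; rule subsetI)
    fix e assume e: "e \<in> E"
    then obtain i j where ij: "e = {p ! i, p ! j}" "i < j" "j < k" using edge_form by blast
    then consider "j = Suc i" | "i = 0" "j = k - 1" using edges e by blast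
    then show "e \<in> {{p ! i, p ! (Suc i mod k)} |i. i < k}"
    proof cases
      case 1
      then show ?thesis using ij by (auto intro!: exI[of _ i])
    next
      case 2
      then have "e = {p ! (k - 1), p ! (Suc (k - 1) mod k)}" using ij k by (simp add: insert_commute)
      then show ?thesis using k by (auto intro!: exI[of _ "k - 1"])
    qed
  next
    fix e assume "e \<in> {{p ! i, p ! (Suc i mod k)} |i. i < k}"
    then obtain i where i: "e = {p ! i, p ! (Suc i mod k)}" "i < k" by blast
    show "e \<in> E"
    proof (cases "Suc i < k")
      case True
      then show ?thesis using i pE by simp
    next
      case False
      then have "Suc i = k" using i by simp
      then show ?thesis using i cyc by (auto simp: insert_commute)
    qed
  qed
  moreover have "bij_betw (\<lambda>i. p ! i) {..<k} V"
    using bij_betw_nth[OF dist, of "{..<k}" V] setp by (simp add: k_def lessThan_def)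
  ultimately show ?thesis
    using cyc V(1) unfolding odd_cycle_def cycle_graph_def card_V by blast
qed

lemma complete_intersection_edge_ideal:
  fixes c :: "'k::field"
  assumes G: "simple_graph {1..n} E" and conn: "connected_graph {1..n} E"
    and nb: "\<not> bipartite_graph {1..n} E" and c: "c \<noteq> 0"
  shows "complete_intersection (xy_vars n) (edge_ideal c n E) \<longleftrightarrow> odd_cycle {1..n} E"
  unfolding complete_intersection_edge_ideal_iff[OF G]
proof
  assume ci: "enat (card E) = height (poly_ring (xy_vars n)) (edge_ideal c n E)"
  have finE: "finite E"
    using G by (intro finite_subset[of E "Pow {1..n}"]) (auto simp: simple_graph_def)
  show "odd_cycle {1..n} E"
  proof (rule odd_cycle_if_max_degree_2[OF G conn nb])
    fix v assume "v \<in> {1..n}"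
    \<comment> \<open>Setting \<open>v\<close> to zero costs 2 and removes the edges at
      \<open>v\<close>, so |E| is at most 2 + |E| - deg v.\<close>
    then have "card E \<le> 2 * card {v} + card {e \<in> E. e \<inter> {v} = {}}"
      using height_edge_ideal_le[OF G _ c, of "{v}"] by (simp flip: ci)
    moreover have "card E = card {e \<in> E. v \<in> e} + card {e \<in> E. e \<inter> {v} = {}}"
      using finE by (subst card_Un_disjoint[symmetric]) (auto intro!: arg_cong[of _ _ card])
    ultimately show "card {e \<in> E. v \<in> e} \<le> 2" by simp
  qed
next
  assume C: "odd_cycle {1..n} E"
  then obtain cc where "E = (\<lambda>i. {cc i, cc (Suc i mod n)}) ` {..<n}"
    by (auto simp: odd_cycle_def cycle_graph_def)
  \<comment> \<open>One inequality suffices here: the bounds n \<le> height \<le> |E| \<le> n force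
    equality.\<close>
  then have "card E \<le> n" using card_image_le[of "{..<n}"] by fastforce
  moreover have "enat (2 * n - n) \<le> height (poly_ring (xy_vars n)) (edge_ideal c n E)"
    using height_ge[OF card_xy_vars(1)] odd_cycle_indep_bound[OF G C c] card_xy_vars(2)[of n] by metis
  moreover have "height (poly_ring (xy_vars n)) (edge_ideal c n E) \<le> enat (card E)"
    using height_edge_ideal_le[OF G _ c, of "{}"] by simp
  ultimately show "enat (card E) = height (poly_ring (xy_vars n)) (edge_ideal c n E)"
    by (metis antisym diff_add_inverse2 enat_ord_simps(1) mult_2 order_trans)
qed

theorem theorem3p5:
  fixes n :: nat and E :: "nat set set"
  assumes "simple_graph {1..n} E"
    and "connected_graph {1..n} E"
    and "\<not> bipartite_graph {1..n} E"
  shows "(complete_intersection (xy_vars n) (LSS_ideal n E :: (xy, 'k::field) mpoly set)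
            \<longleftrightarrow> odd_cycle {1..n} E)
       \<and> (odd_cycle {1..n} E
            \<longleftrightarrow> complete_intersection (xy_vars n)
                  (parity_binomial_edge_ideal n E :: (xy, 'k) mpoly set))"
  unfolding LSS_ideal_eq parity_binomial_edge_ideal_eq
  using complete_intersection_edge_ideal[OF assms, of "1 :: 'k"]
    complete_intersection_edge_ideal[OF assms, of "- 1 :: 'k"] by simp

end
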